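(* Let $b\geq 2$ be an integer and let $A=(a_n)_{n=1}^{\infty}$ be a strictly increasing sequence of positive integers. Suppose that $\eta:=\lim_{n\to\infty}\frac{a_{n+1}}{a_n}$ exists and $1<\eta<+\infty$. Let $$l_0=\max\left\{1,\left\lfloor\frac{\log 2-\log(\eta-1)}{\log\eta}\right\rfloor+1\right\}.$$ Then for any $$\hat v\in\bigcup_{l=l_0}^{\infty}\left[\eta-\frac{\eta^{l}+\eta^{l+1}-1}{\eta^{2l}},\ \eta-\frac{2}{\eta^{l}}\right],$$ we have $$\dim_{\rm H}(\hat{\mathcal V}^{\ast}_{b,A}(\hat v))=\dim_{\rm H}(\hat{\mathcal V}_{b,A}(\hat v))=\frac{\eta^{\tilde l+1}-1-\eta^{\tilde l}\hat v}{(\eta^{\tilde l+1}-1)(1+\eta^{\tilde l}\hat v)},$$ where $$\tilde l=\tilde l(\hat v):=\max\left\{1,\left\lfloor\frac{\log(\eta+1)-\log(\eta-\hat v)}{\log\eta}\right\rfloor\right\}.$$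
   Context: $\|x\|$ denotes the distance from $x\in\mathbb R$ to the nearest integer; $\dim_{\rm H}$ is Hausdorff dimension; $\lfloor\cdot\rfloor$ is the floor function. For real $\xi$, $$\hat v_{b,A}(\xi):=\sup\Big\{\hat v\ge 0:\ \text{for all sufficiently large integers }N,\ \min_{1\le n\le N}\|b^{a_n}\xi\|<(b^{a_N})^{-\hat v}\Big\}\in[0,+\infty].$$ (The exponent is introduced for irrational $\xi$; for rational $\xi$ the same formula is used.) For $\hat v\in[0,\eta]$, $$\hat{\mathcal V}_{b,A}(\hat v):=\{\xi\in\mathbb R:\hat v_{b,A}(\xi)\ge\hat v\},\qquad \hat{\mathcal V}^{\ast}_{b,A}(\hat v):=\{\xi\in\mathbb R:\hat v_{b,A}(\xi)=\hat v\}.$$ *)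

theory Defs
  imports "HOL-Analysis.Analysis"
begin

(* Summand of the Hausdorff measure, with the conventions that the empty set contributes 0
   for every s and that diam(U)^0 = 1 for nonempty U (whereas 0 powr 0 = 0 in HOL). *)
definition diam_pow :: "real \<Rightarrow> 'a::metric_space set \<Rightarrow> ennreal" where
  "diam_pow s U = (if U = {} then 0 else if s = 0 then 1 else ennreal (diameter U powr s))"

(* Boundedness is required separately because diameter has an unspecified value on unbounded
   sets. Finite covers are included by padding with empty sets. *)
definition hausdorff_premeasure :: "real \<Rightarrow> real \<Rightarrow> 'a::metric_space set \<Rightarrow> ennreal" where
  "hausdorff_premeasure \<delta> s S =
     Inf {(\<Sum>i. diam_pow s (U i)) | U :: nat \<Rightarrow> 'a set.
            S \<subseteq> (\<Union>i. U i) \<and> (\<forall>i. bounded (U i) \<and> diameter (U i) \<le> \<delta>)}"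

definition hausdorff_measure :: "real \<Rightarrow> 'a::metric_space set \<Rightarrow> ennreal" where
  "hausdorff_measure s S = (SUP \<delta>\<in>{0<..}. hausdorff_premeasure \<delta> s S)"

definition hausdorff_dim :: "'a::metric_space set \<Rightarrow> ereal" where
  "hausdorff_dim S = Inf {ereal s | s. 0 \<le> s \<and> hausdorff_measure s S = 0}"

definition dist_nearest_int :: "real \<Rightarrow> real" where
  "dist_nearest_int x = infdist x \<int>"

(* In all definitions below the sequence A = (a_n) is indexed from n = 1; a 0 is never
   relevant. *)
definition v_hat :: "int \<Rightarrow> (nat \<Rightarrow> nat) \<Rightarrow> real \<Rightarrow> ereal" where
  "v_hat b a \<xi> = Sup {ereal v | v. 0 \<le> v \<and>
     (\<forall>\<^sub>F N in sequentially.
        Min ((\<lambda>n. dist_nearest_int (of_int b ^ a n * \<xi>)) ` {1..N})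
          < (of_int b ^ a N) powr (- v))}"

definition V_set :: "int \<Rightarrow> (nat \<Rightarrow> nat) \<Rightarrow> real \<Rightarrow> real set" where
  "V_set b a v = {\<xi>. v_hat b a \<xi> \<ge> ereal v}"

definition V_star_set :: "int \<Rightarrow> (nat \<Rightarrow> nat) \<Rightarrow> real \<Rightarrow> real set" where
  "V_star_set b a v = {\<xi>. v_hat b a \<xi> = ereal v}"

(* The conversion nat in the next two definitions is harmless: its argument is at least 1. *)
definition l_zero :: "real \<Rightarrow> nat" where
  "l_zero \<eta> = nat (max 1 (\<lfloor>(ln 2 - ln (\<eta> - 1)) / ln \<eta>\<rfloor> + 1))"

definition l_tilde :: "real \<Rightarrow> real \<Rightarrow> nat" where
  "l_tilde \<eta> v = nat (max 1 \<lfloor>(ln (\<eta> + 1) - ln (\<eta> - v)) / ln \<eta>\<rfloor>)"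

end

theory Submission
  imports Defs
begin

text \<open>Call \<open>n\<close> a record of \<open>\<xi>\<close> if \<open>\<parallel>b ^ a n \<xi>\<parallel>\<close> is smaller than all its predecessors. If
  \<open>n < n' = n + i + 1\<close> are consecutive records, the uniform exponent forces \<open>\<xi>\<close> to have a run of
  about \<open>v \<eta>\<^sup>i a n\<close> digits \<open>0\<close> or \<open>b - 1\<close> after position \<open>a n\<close>, and the digits from its end up to
  position \<open>a n' \<approx> \<eta>\<^sup>i\<^sup>+\<^sup>1 a n\<close> are unconstrained. Keeping \<open>i\<close> constant gives a Cantor set of dimension
  \<open>block_dim \<eta> v i\<close>.

  Conversely, let \<open>s\<close> exceed all these numbers, and suppose that the points with record \<open>n\<close> and
  given nearest integer can be covered at cost \<open>b powr (- y a n)\<close> for the exponent \<open>s\<close>. For each \<open>i\<close>,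
  either the single ball given by the run or the covers at the next record show that
  \<open>y\<close> can be increased by a fixed amount, so finally \<open>y > 1\<close> and the set is null. In
  the given range of \<open>v\<close>, \<open>block_dim \<eta> v i\<close> is maximal at \<open>i = l_tilde \<eta> v\<close>.\<close>

section \<open>Hausdorff measure\<close>

text \<open>The Cantor sets keep the gap between records constant, whereas a general point may vary
  it from record to record; the upper bound must show that mixing gaps gains nothing. Counting over
  all sequences of gaps is avoided because the single number \<open>y\<close> stands for the cost of
  the whole future of a point, and a gap \<open>i\<close> acts on it by an affine map. The fixed
  point of this map is \<open>block_dim \<eta> v i * (1 + v * \<eta> ^ i)\<close>, and
  \<open>1 + v * \<eta> ^ i\<close> is the exponent of the ball given by the run; hence
  \<open>block_dim\<close> is the threshold for \<open>s\<close>. Gaps are unbounded, but from some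
  \<open>L\<close> on the ball alone has a cost exponent above \<open>1\<close>, so finitely many
  maps remain and one gain serves them all. The value \<open>1\<close> for \<open>y\<close> is
  critical since a unit interval holds about \<open>b ^ a n\<close> candidates
  \<open>p / b ^ a n\<close>. Costs are premeasures for a fixed \<delta>, so that subadditivity
  replaces explicit covers. Rational points have only finitely many records; being countable, they
  are removed beforehand.\<close>

lemma hausdorff_premeasure_le:
  assumes "S \<subseteq> (\<Union>i. U i)" "\<And>i. bounded (U i)" "\<And>i. diameter (U i) \<le> \<delta>"
  shows "hausdorff_premeasure \<delta> s S \<le> (\<Sum>i. diam_pow s (U i))"
  unfolding hausdorff_premeasure_def using assms by (intro Inf_lower) blast

lemma hausdorff_premeasure_mono:
  "S \<subseteq> T \<Longrightarrow> hausdorff_premeasure \<delta> s S \<le> hausdorff_premeasure \<delta> s T"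
  unfolding hausdorff_premeasure_def by (intro Inf_superset_mono) blast

lemma hausdorff_premeasure_le_diam_pow:
  assumes "bounded U" "diameter U \<le> \<delta>" "0 \<le> \<delta>"
  shows "hausdorff_premeasure \<delta> s U \<le> diam_pow s U"
proof -
  define W where "W = (\<lambda>i::nat. if i = 0 then U else {})"
  have "hausdorff_premeasure \<delta> s U \<le> (\<Sum>i. diam_pow s (W i))"
    by (intro hausdorff_premeasure_le) (use assms in \<open>auto simp: W_def\<close>)
  also have "\<dots> = (\<Sum>i\<in>{0}. diam_pow s (W i))"
    by (intro suminf_finite) (auto simp: W_def diam_pow_def)
  finally show ?thesis by (simp add: W_def)
qed

lemma hausdorff_premeasure_empty:
  "0 \<le> \<delta> \<Longrightarrow> hausdorff_premeasure \<delta> s {} = 0"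
  using hausdorff_premeasure_le_diam_pow[of "{}" \<delta> s] by (simp add: diam_pow_def)

lemma hausdorff_premeasure_UN_nat:
  fixes S :: "nat \<Rightarrow> 'a::metric_space set"
  shows "hausdorff_premeasure \<delta> s (\<Union>i. S i) \<le> (\<Sum>i. hausdorff_premeasure \<delta> s (S i))"
proof (rule ennreal_le_epsilon)
  fix e :: real
  assume fin: "(\<Sum>i. hausdorff_premeasure \<delta> s (S i)) < top" and e: "0 < e"
  define p where "p i = ennreal (e * (1/2)^Suc i)" for i
  have "\<exists>U. S i \<subseteq> (\<Union>k. U k) \<and> (\<forall>k. bounded (U k) \<and> diameter (U k) \<le> \<delta>)
     \<and> (\<Sum>k. diam_pow s (U k)) \<le> hausdorff_premeasure \<delta> s (S i) + p i" for i
  proof -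
    \<comment> \<open>Finiteness makes adding \<open>p i\<close> a strict increase, so that the
      infimum provides a cover.\<close>
    have "hausdorff_premeasure \<delta> s (S i) \<noteq> top"
      using ennreal_suminf_lessD[OF fin, of i] by auto
    then have "hausdorff_premeasure \<delta> s (S i) < hausdorff_premeasure \<delta> s (S i) + p i"
      using e ennreal_add_left_cancel_less[of "hausdorff_premeasure \<delta> s (S i)" 0 "p i"] by (simp add: p_def)
    then show ?thesis
      unfolding hausdorff_premeasure_def[of \<delta> s "S i"] Inf_less_iff by (auto intro: less_imp_le)
  qed
  then obtain U where U: "\<And>i. S i \<subseteq> (\<Union>k. U i k)" "\<And>i k. bounded (U i k)"
     "\<And>i k. diameter (U i k) \<le> \<delta>"
     "\<And>i. (\<Sum>k. diam_pow s (U i k)) \<le> hausdorff_premeasure \<delta> s (S i) + p i"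
    by metis
  define W where "W = (\<lambda>(i, k). U i k) \<circ> prod_decode"
  have "(\<Union>i. S i) \<subseteq> (\<Union>n. W n)"
  proof
    fix x assume "x \<in> (\<Union>i. S i)"
    then obtain i k where "x \<in> U i k" using U(1) by blast
    then have "x \<in> W (prod_encode (i, k))" by (simp add: W_def)
    then show "x \<in> (\<Union>n. W n)" by blast
  qed
  then have "hausdorff_premeasure \<delta> s (\<Union>i. S i) \<le> (\<Sum>n. diam_pow s (W n))"
    by (intro hausdorff_premeasure_le) (auto simp: W_def U split: prod.split)
  also have "\<dots> = (\<Sum>n. ((\<lambda>(i, k). diam_pow s (U i k)) \<circ> prod_decode) n)"
    by (simp add: W_def o_def case_prod_unfold)
  also have "\<dots> = (\<Sum>i. \<Sum>k. diam_pow s (U i k))"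
    unfolding o_def by (intro suminf_ennreal_2dimen) simp
  also have "\<dots> \<le> (\<Sum>i. hausdorff_premeasure \<delta> s (S i) + p i)"
    by (intro suminf_le U) auto
  also have "\<dots> = (\<Sum>i. hausdorff_premeasure \<delta> s (S i)) + (\<Sum>i. p i)"
    by (intro suminf_add[symmetric]) auto
  also have "(\<Sum>i. p i) = ennreal e"
  proof -
    have "(\<lambda>i. e * (1/2)^Suc i) sums (e * 1)"
      by (intro sums_mult power_half_series)
    then show ?thesis
      unfolding p_def using e by (intro suminf_ennreal_eq) auto
  qed
  finally show "hausdorff_premeasure \<delta> s (\<Union>i. S i) \<le>
    (\<Sum>i. hausdorff_premeasure \<delta> s (S i)) + ennreal e" .
qed

lemma hausdorff_premeasure_Un:
  assumes "0 \<le> \<delta>"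
  shows "hausdorff_premeasure \<delta> s (S \<union> T) \<le> hausdorff_premeasure \<delta> s S + hausdorff_premeasure \<delta> s T"
proof -
  define W where "W = (\<lambda>i::nat. if i = 0 then S else if i = 1 then T else {})"
  have "S \<union> T = (\<Union>i. W i)"
    by (auto simp: W_def split: if_splits)
  then have "hausdorff_premeasure \<delta> s (S \<union> T) \<le> (\<Sum>i. hausdorff_premeasure \<delta> s (W i))"
    using hausdorff_premeasure_UN_nat[of \<delta> s W] by simp
  also have "\<dots> = (\<Sum>i\<in>{0,1}. hausdorff_premeasure \<delta> s (W i))"
    by (intro suminf_finite) (auto simp: W_def hausdorff_premeasure_empty assms)
  finally show ?thesis by (simp add: W_def)
qed

lemma hausdorff_premeasure_UN_finite:
  assumes "0 \<le> \<delta>" "finite I"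
  shows "hausdorff_premeasure \<delta> s (\<Union>i\<in>I. S i) \<le> (\<Sum>i\<in>I. hausdorff_premeasure \<delta> s (S i))"
  using assms(2)
proof (induction I rule: finite_induct)
  case empty
  then show ?case by (simp add: hausdorff_premeasure_empty assms)
next
  case (insert i I)
  have "hausdorff_premeasure \<delta> s (\<Union>i\<in>insert i I. S i)
      \<le> hausdorff_premeasure \<delta> s (S i) + hausdorff_premeasure \<delta> s (\<Union>i\<in>I. S i)"
    using hausdorff_premeasure_Un[OF assms(1), of s "S i" "\<Union>i\<in>I. S i"] by simp
  also have "\<dots> \<le> hausdorff_premeasure \<delta> s (S i) + (\<Sum>i\<in>I. hausdorff_premeasure \<delta> s (S i))"
    by (intro add_left_mono insert)
  finally show ?case using insert by simp
qed

lemma hausdorff_premeasure_cball_le: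
  fixes c r :: real
  assumes "0 < s" "0 \<le> r" "2 * r \<le> \<delta>"
  shows "hausdorff_premeasure \<delta> s {x. \<bar>x - c\<bar> \<le> r} \<le> ennreal ((2 * r) powr s)"
proof -
  have eq: "{x. \<bar>x - c\<bar> \<le> r} = {c - r..c + r}" by auto
  have "diameter {c - r..c + r} = 2 * r"
    using assms by (subst diameter_closed_interval) auto
  then have "hausdorff_premeasure \<delta> s {c - r..c + r} \<le> diam_pow s {c - r..c + r}"
    using assms by (intro hausdorff_premeasure_le_diam_pow) auto
  with assms \<open>diameter {c - r..c + r} = 2 * r\<close> show ?thesis
    unfolding eq diam_pow_def by (auto split: if_splits)
qed

section \<open>Null sets and Hausdorff dimension\<close>

lemma hausdorff_measure_eq_0_iff:
  "hausdorff_measure s S = 0 \<longleftrightarrow> (\<forall>\<delta>>0. hausdorff_premeasure \<delta> s S = 0)"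
  unfolding hausdorff_measure_def bot_ennreal[symmetric] SUP_bot_conv by auto

lemma hausdorff_measure_null_mono:
  "hausdorff_measure s T = 0 \<Longrightarrow> S \<subseteq> T \<Longrightarrow> hausdorff_measure s S = 0"
  unfolding hausdorff_measure_eq_0_iff
  by (metis hausdorff_premeasure_mono le_zero_eq)

lemma hausdorff_measure_null_UN:
  assumes "countable I" "\<And>i. i \<in> I \<Longrightarrow> hausdorff_measure s (S i) = 0"
  shows "hausdorff_measure s (\<Union>i\<in>I. S i) = 0"
  unfolding hausdorff_measure_eq_0_iff
proof (intro allI impI)
  fix \<delta> :: real assume d: "0 < \<delta>"
  show "hausdorff_premeasure \<delta> s (\<Union>i\<in>I. S i) = 0"
  proof (cases "I = {}")
    case True then show ?thesis using d by (simp add: hausdorff_premeasure_empty)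
  next
    case False
    have "(\<Union>i\<in>I. S i) = (\<Union>n. S (from_nat_into I n))"
      using range_from_nat_into[OF False assms(1)] by (metis image_image)
    then have "hausdorff_premeasure \<delta> s (\<Union>i\<in>I. S i)
        \<le> (\<Sum>n. hausdorff_premeasure \<delta> s (S (from_nat_into I n)))"
      using hausdorff_premeasure_UN_nat[of \<delta> s "\<lambda>n. S (from_nat_into I n)"] by simp
    also have "\<dots> = (\<Sum>n. 0)"
      using assms(2)[OF from_nat_into[OF False]] d
      by (simp add: hausdorff_measure_eq_0_iff)
    finally show ?thesis by simp
  qed
qed

lemma hausdorff_measure_null_countable:
  fixes S :: "real set"
  assumes "countable S" "0 < s"
  shows "hausdorff_measure s S = 0"
proof -
  have "hausdorff_measure s {x} = 0" for x :: real
    unfolding hausdorff_measure_eq_0_iff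
  proof (intro allI impI)
    fix \<delta> :: real assume d: "0 < \<delta>"
    then have "hausdorff_premeasure \<delta> s {x} \<le> diam_pow s {x}"
      by (intro hausdorff_premeasure_le_diam_pow) auto
    then show "hausdorff_premeasure \<delta> s {x} = 0"
      using assms(2) by (simp add: diam_pow_def)
  qed
  then have "hausdorff_measure s (\<Union>x\<in>S. {x}) = 0"
    using assms(1) by (intro hausdorff_measure_null_UN)
  then show ?thesis by simp
qed

lemma hausdorff_dim_mono: "S \<subseteq> T \<Longrightarrow> hausdorff_dim S \<le> hausdorff_dim T"
  unfolding hausdorff_dim_def
  by (intro Inf_superset_mono) (use hausdorff_measure_null_mono in blast)

lemma hausdorff_dim_le:
  assumes "0 \<le> D" "\<And>s. D < s \<Longrightarrow> hausdorff_measure s S = 0"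
  shows "hausdorff_dim S \<le> ereal D"
proof (rule ereal_le_epsilon2)
  fix e :: real assume "0 < e"
  then have "hausdorff_dim S \<le> ereal (D + e)"
    unfolding hausdorff_dim_def using assms by (intro Inf_lower) (auto intro!: exI[of _ "D + e"])
  then show "hausdorff_dim S \<le> ereal D + ereal e" by simp
qed

lemma hausdorff_dim_ge:
  assumes "\<And>s. 0 \<le> s \<Longrightarrow> s < D \<Longrightarrow> hausdorff_measure s S \<noteq> 0"
  shows "ereal D \<le> hausdorff_dim S"
  unfolding hausdorff_dim_def using assms by (intro Inf_greatest) (force simp: not_less[symmetric])

text \<open>Supplies the exponent \<open>0\<close>, which the Hoelder criterion below excludes:
  every nonempty member of a cover contributes \<open>1\<close>.\<close>

lemma hausdorff_measure_0_ne_0: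
  assumes "S \<noteq> {}"
  shows "hausdorff_measure 0 S \<noteq> 0"
proof
  assume "hausdorff_measure 0 S = 0"
  then have "hausdorff_premeasure 1 0 S < 1" by (simp add: hausdorff_measure_eq_0_iff)
  then obtain U where U: "S \<subseteq> (\<Union>i::nat. U i)" and less: "(\<Sum>i. diam_pow 0 (U i)) < 1"
    unfolding hausdorff_premeasure_def Inf_less_iff by auto
  obtain i where "U i \<noteq> {}" using U assms by fastforce
  then have "1 \<le> (\<Sum>i. diam_pow 0 (U i))"
    using sum_le_suminf[of "\<lambda>i. diam_pow 0 (U i)" "{i}"] by (simp add: diam_pow_def)
  with less show False by simp
qed

text \<open>A cover of \<open>S\<close> pulls back under \<open>g\<close> to a cover of the unit interval, which has Lebesgue
  measure \<open>1\<close>; so no mass distribution has to be constructed on \<open>S\<close>.\<close>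

lemma hausdorff_measure_pos_if_inverse_Hoelder:
  fixes g :: "real \<Rightarrow> real"
  assumes C: "0 < C" and s: "0 < s" and g: "\<And>t. t \<in> {0..<1} \<Longrightarrow> g t \<in> S"
    and H: "\<And>t t'. t \<in> {0..<1} \<Longrightarrow> t' \<in> {0..<1} \<Longrightarrow> \<bar>t - t'\<bar> \<le> C * \<bar>g t - g t'\<bar> powr s"
  shows "hausdorff_measure s S \<noteq> 0"
proof
  \<comment> \<open>A parameter interval of radius \<open>C * diameter (U i) powr s\<close> has
    length \<open>K\<close> times the summand of \<open>U i\<close>.\<close>
  define K where "K = 2 * C"
  assume "hausdorff_measure s S = 0"
  then have "hausdorff_premeasure 1 s S = 0"
    by (simp add: hausdorff_measure_eq_0_iff)
  then have "hausdorff_premeasure 1 s S < ennreal (1 / K)"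
    using C by (simp add: K_def)
  then obtain U where U: "S \<subseteq> (\<Union>i::nat. U i)" "\<And>i. bounded (U i)"
    and less: "(\<Sum>i. diam_pow s (U i)) < ennreal (1 / K)"
    unfolding hausdorff_premeasure_def Inf_less_iff by auto
  define T where "T i = {t\<in>{0..<1}. g t \<in> U i}" for i
  \<comment> \<open>\<open>g\<close> is arbitrary, so \<open>T i\<close> may fail to be measurable;
    it is replaced by an interval around one of its points.\<close>
  have "\<exists>I\<in>sets lborel. T i \<subseteq> I \<and> emeasure lborel I \<le> ennreal K * diam_pow s (U i)" for i
  proof (cases "T i = {}")
    case True then show ?thesis by (intro bexI[of _ "{}"]) auto
  next
    case False
    then obtain t0 where t0: "t0 \<in> T i" by blast
    then have ne: "U i \<noteq> {}" by (auto simp: T_def)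
    define d where "d = C * diameter (U i) powr s"
    have d0: "0 \<le> d" using C by (auto simp: d_def)
    have "T i \<subseteq> {t0 - d..t0 + d}"
    proof
      fix t assume t: "t \<in> T i"
      have "\<bar>t - t0\<bar> \<le> d"
      proof -
        have "\<bar>t - t0\<bar> \<le> C * \<bar>g t - g t0\<bar> powr s"
          using t t0 by (intro H) (auto simp: T_def)
        also have "\<bar>g t - g t0\<bar> \<le> diameter (U i)"
          using diameter_bounded_bound[OF U(2), of "g t" i "g t0"] t t0
          by (auto simp: T_def dist_real_def)
        then have "C * \<bar>g t - g t0\<bar> powr s \<le> C * diameter (U i) powr s"
          using C s by (intro mult_left_mono powr_mono2) auto
        finally show ?thesis by (simp add: d_def)
      qed
      then show "t \<in> {t0 - d..t0 + d}" by auto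
    qed
    moreover have "emeasure lborel {t0 - d..t0 + d} \<le> ennreal K * diam_pow s (U i)"
    proof -
      have "emeasure lborel {t0 - d..t0 + d} = ennreal (2 * d)" using d0 by simp
      also have "\<dots> = ennreal (K * diameter (U i) powr s)"
        by (simp add: d_def K_def mult.assoc)
      also have "\<dots> = ennreal K * diam_pow s (U i)"
        using ne C s by (auto simp: diam_pow_def K_def ennreal_mult)
      finally show ?thesis by simp
    qed
    ultimately show ?thesis by (intro bexI[of _ "{t0 - d..t0 + d}"]) auto
  qed
  then obtain I where I: "\<And>i. I i \<in> sets lborel" "\<And>i. T i \<subseteq> I i"
      "\<And>i. emeasure lborel (I i) \<le> ennreal K * diam_pow s (U i)" by metis
  have "{0..<1::real} \<subseteq> (\<Union>i. I i)"
  proof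
    fix t :: real assume "t \<in> {0..<1}"
    then obtain i where "g t \<in> U i" using U(1) g by blast
    then show "t \<in> (\<Union>i. I i)" using I(2)[of i] \<open>t \<in> _\<close> by (auto simp: T_def)
  qed
  then have "emeasure lborel {0..<1::real} \<le> emeasure lborel (\<Union>i. I i)"
    using I(1) by (intro emeasure_mono sets.countable_UN) auto
  also have "\<dots> \<le> (\<Sum>i. emeasure lborel (I i))"
    using I(1) by (intro emeasure_subadditive_countably) auto
  also have "\<dots> \<le> (\<Sum>i. ennreal K * diam_pow s (U i))"
    by (intro suminf_le I) auto
  also have "\<dots> = ennreal K * (\<Sum>i. diam_pow s (U i))" by simp
  also have "\<dots> < ennreal K * ennreal (1 / K)"
    using less C by (intro ennreal_mult_strict_left_mono) (auto simp: K_def)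
  also have "\<dots> = 1" using C by (simp add: K_def flip: ennreal_mult)
  finally show False by simp
qed

section \<open>Expansions in base b\<close>

lemma dist_nearest_int_le: "dist_nearest_int x \<le> \<bar>x - of_int p\<bar>"
  unfolding dist_nearest_int_def dist_real_def[symmetric] by (intro infdist_le) auto

lemma dist_nearest_int_attained: "\<exists>p. dist_nearest_int x = \<bar>x - of_int p\<bar>"
proof -
  obtain y where "y \<in> \<int>" "infdist x \<int> = dist x y"
    using infdist_attains_inf[of "\<int> :: real set" x] Ints_0 by (metis closed_Ints empty_iff)
  then show ?thesis by (auto simp: dist_nearest_int_def dist_real_def elim!: Ints_cases)
qed

lemma dist_nearest_int_ge:
  assumes "x - y \<in> \<int>" "r \<le> y" "y \<le> 1 - r"
  shows "r \<le> dist_nearest_int x"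
proof -
  obtain p where p: "dist_nearest_int x = \<bar>x - of_int p\<bar>"
    using dist_nearest_int_attained by blast
  obtain q where q: "x - y = of_int q" using assms(1) by (auto elim: Ints_cases)
  have "r \<le> \<bar>y + of_int (q - p)\<bar>"
  proof (cases "q - p \<ge> 0")
    case True
    then have "(of_int (q - p) :: real) \<ge> 0" by simp
    then show ?thesis using assms by linarith
  next
    case False
    then have "(of_int (q - p) :: real) \<le> -1" by (simp add: of_int_le_iff[of _ "-1", simplified, symmetric] del: of_int_diff)
    then show ?thesis using assms by linarith
  qed
  then show ?thesis using p q by (simp add: algebra_simps)
qed

locale base =
  fixes b :: int
  assumes b2: "b \<ge> 2"
begin

abbreviation B :: real where "B \<equiv> of_int b"

lemma B2: "B \<ge> 2" using b2 by linarith
lemma b_simps [simp]: "0 < b" "0 \<le> b" "1 < b" "1 \<le> b" "b \<noteq> 0" "b \<noteq> 1" "\<bar>b\<bar> = b"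
  using b2 by auto

lemma powr_minus_nat: "B powr (- real n) = 1 / B ^ n"
  by (simp add: powr_minus powr_realpow inverse_eq_divide)

lemma B_pos: "B > 0" by simp
lemma B_gt1: "B > 1" by simp

definition digit_seq :: "(nat \<Rightarrow> int) \<Rightarrow> bool" where
  "digit_seq d \<longleftrightarrow> (\<forall>i. 0 \<le> d i \<and> d i \<le> b - 1)"

text \<open>This is \<open>B ^ m * expand d\<close> modulo \<open>1\<close>. It lies in the closed
  unit interval: the value \<open>1\<close> occurs if all later digits are
  \<open>b - 1\<close>.\<close>

definition tail :: "(nat \<Rightarrow> int) \<Rightarrow> nat \<Rightarrow> real" where
  "tail d m = (\<Sum>i. of_int (d (m + i + 1)) / B ^ (i + 1))"

text \<open>Index \<open>0\<close> holds the integer part, so that the digit at index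
  \<open>i\<close> has weight \<open>1 / B ^ i\<close>.\<close>

definition expand :: "(nat \<Rightarrow> int) \<Rightarrow> real" where
  "expand d = of_int (d 0) + tail d 0"

lemma digit_seqD: "digit_seq d \<Longrightarrow> 0 \<le> d i" "digit_seq d \<Longrightarrow> d i \<le> b - 1"
  by (auto simp: digit_seq_def)

lemma digit_seq_bounds:
  assumes "digit_seq d"
  shows "0 \<le> (of_int (d i) :: real)" "of_int (d i) \<le> B - 1"
proof -
  show "0 \<le> (of_int (d i) :: real)" using digit_seqD(1)[OF assms, of i] by simp
  have "(of_int (d i) :: real) \<le> of_int (b - 1)"
    unfolding of_int_le_iff by (rule digit_seqD(2)[OF assms])
  then show "of_int (d i) \<le> B - 1" by simp
qed

lemma top_digit_sums: "(\<lambda>i. (B - 1) / B ^ (i + 1)) sums 1"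
proof -
  have "(\<lambda>i. (1 / B) ^ i) sums (1 / (1 - 1 / B))"
    by (intro geometric_sums) simp
  then have "(\<lambda>i. (B - 1) / B * (1 / B) ^ i) sums ((B - 1) / B * (1 / (1 - 1 / B)))"
    by (rule sums_mult)
  moreover have "(B - 1) / B * (1 / (1 - 1 / B)) = 1"
    using B_gt1 by (simp add: field_simps)
  ultimately show ?thesis by (simp add: power_divide)
qed

lemma summable_tail:
  assumes "digit_seq d"
  shows "summable (\<lambda>i. of_int (d (m + i + 1)) / B ^ (i + 1))"
proof (rule summable_comparison_test')
  show "summable (\<lambda>i. (B - 1) / B ^ (i + 1))" using top_digit_sums by (rule sums_summable)
  show "norm (of_int (d (m + i + 1)) / B ^ (i + 1)) \<le> (B - 1) / B ^ (i + 1)" for i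
    using digit_seq_bounds[OF assms, of "m + i + 1"] by (auto intro!: divide_right_mono)
qed

lemma tail_nonneg: "digit_seq d \<Longrightarrow> 0 \<le> tail d m"
  unfolding tail_def using digit_seq_bounds by (intro suminf_nonneg summable_tail) auto

lemma tail_le_1:
  assumes "digit_seq d"
  shows "tail d m \<le> 1"
proof -
  have "tail d m \<le> (\<Sum>i. (B - 1) / B ^ (i + 1))"
    unfolding tail_def using top_digit_sums digit_seq_bounds(2)[OF assms]
    by (intro suminf_le summable_tail assms) (auto intro!: divide_right_mono simp: sums_iff)
  then show ?thesis using top_digit_sums by (simp add: sums_iff)
qed

lemma tail_rec:
  assumes "digit_seq d"
  shows "tail d m = (of_int (d (Suc m)) + tail d (Suc m)) / B"
proof -
  define f where "f i = of_int (d (m + i + 1)) / B ^ (i + 1)" for i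
  have "tail d m = f 0 + (\<Sum>i. f (Suc i))"
    unfolding tail_def f_def[symmetric] using summable_tail[OF assms, of m]
    by (subst suminf_split_head) (auto simp: f_def[abs_def])
  also have "(\<Sum>i. f (Suc i)) = (\<Sum>i. of_int (d (Suc m + i + 1)) / B ^ (i + 1) / B)"
    by (intro suminf_cong) (simp add: f_def mult_ac)
  also have "\<dots> = tail d (Suc m) / B"
    unfolding tail_def by (intro suminf_divide summable_tail assms)
  finally show ?thesis by (simp add: f_def add_divide_distrib)
qed

lemma power_expand_minus_tail_Ints:
  assumes "digit_seq d"
  shows "B ^ m * expand d - tail d m \<in> \<int>"
proof (induction m)
  case 0
  then show ?case by (simp add: expand_def)
next
  case (Suc m)
  have "B * tail d m = of_int (d (Suc m)) + tail d (Suc m)"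
    by (subst tail_rec[OF assms]) simp
  then have "B ^ Suc m * expand d - tail d (Suc m)
      = B * (B ^ m * expand d - tail d m) + of_int (d (Suc m))"
    by (simp add: algebra_simps)
  then show ?case using Suc by simp
qed

lemma tail_ge:
  assumes "digit_seq d" "d (m + p) \<ge> 1" "p \<ge> 1"
  shows "1 / B ^ p \<le> tail d m"
  using assms(3,2)
proof (induction p arbitrary: m rule: dec_induct)
  case base
  then have "1 \<le> (of_int (d (Suc m)) :: real)" by simp
  then show ?case
    using tail_nonneg[OF assms(1), of "Suc m"] by (simp add: tail_rec[OF assms(1), of m] divide_right_mono)
next
  case (step p)
  have "1 / B ^ p \<le> tail d (Suc m)" by (rule step.IH) (use step.prems in simp)
  also have "\<dots> \<le> of_int (d (Suc m)) + tail d (Suc m)"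
    using digit_seq_bounds[OF assms(1)] by simp
  finally have "1 / B ^ p / B \<le> tail d m"
    unfolding tail_rec[OF assms(1), of m] by (rule divide_right_mono) simp
  then show ?case by (simp add: mult.commute)
qed

text \<open>A digit \<open>0\<close> falls short of the largest digit by at least one unit at its
  place, and the tail falls short of \<open>1\<close> by as much.\<close>

lemma tail_le:
  assumes "digit_seq d" "d (m + p) = 0" "p \<ge> 1"
  shows "tail d m \<le> 1 - 1 / B ^ p"
  using assms(3,2)
proof (induction p arbitrary: m rule: dec_induct)
  case base
  then have "tail d m \<le> 1 / B"
    using tail_le_1[OF assms(1), of "Suc m"] by (simp add: tail_rec[OF assms(1), of m] divide_right_mono)
  also have "\<dots> \<le> 1 - 1 / B" using B2 by (simp add: field_simps)
  finally show ?case by simp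
next
  case (step p)
  have "tail d (Suc m) \<le> 1 - 1 / B ^ p" by (rule step.IH) (use step.prems in simp)
  then have "of_int (d (Suc m)) + tail d (Suc m) \<le> B - 1 / B ^ p"
    using digit_seq_bounds(2)[OF assms(1), of "Suc m"] by simp
  then have "tail d m \<le> (B - 1 / B ^ p) / B"
    unfolding tail_rec[OF assms(1), of m] by (rule divide_right_mono) simp
  also have "\<dots> = 1 - 1 / B ^ Suc p"
    by (simp add: diff_divide_distrib mult.commute)
  finally show ?case .
qed

lemma tail_le_zeros:
  assumes "digit_seq d" "\<And>i. m < i \<Longrightarrow> i \<le> m + p \<Longrightarrow> d i = 0"
  shows "tail d m \<le> 1 / B ^ p"
  using assms(2)
proof (induction p arbitrary: m)
  case 0
  then show ?case using tail_le_1[OF assms(1)] by simp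
next
  case (Suc p)
  have "tail d (Suc m) \<le> 1 / B ^ p" by (rule Suc.IH) (use Suc.prems in auto)
  moreover have "d (Suc m) = 0" by (rule Suc.prems) auto
  ultimately have "tail d m \<le> 1 / B ^ p / B"
    unfolding tail_rec[OF assms(1), of m] by (intro divide_right_mono) auto
  then show ?case by (simp add: mult.commute)
qed

lemma dist_nearest_int_expand_le:
  assumes "digit_seq d" "\<And>i. m < i \<Longrightarrow> i \<le> m + p \<Longrightarrow> d i = 0"
  shows "dist_nearest_int (B ^ m * expand d) \<le> 1 / B ^ p"
proof -
  obtain q where q: "B ^ m * expand d - tail d m = of_int q"
    using power_expand_minus_tail_Ints[OF assms(1)] by (auto elim: Ints_cases)
  have "dist_nearest_int (B ^ m * expand d) \<le> \<bar>B ^ m * expand d - of_int q\<bar>"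
    by (rule dist_nearest_int_le)
  also have "B ^ m * expand d - of_int q = tail d m" using q by simp
  finally show ?thesis
    using tail_nonneg[OF assms(1), of m] tail_le_zeros[OF assms, of m p] by simp
qed

text \<open>A nonzero digit keeps the tail away from \<open>0\<close>, a digit \<open>0\<close>
  keeps it away from \<open>1\<close>. If both occur within \<open>L\<close> places, no integer is
  close.\<close>

lemma dist_nearest_int_expand_ge:
  assumes "digit_seq d" "d (m + p) \<ge> 1" "d (m + p') = 0" "1 \<le> p" "1 \<le> p'" "p \<le> L" "p' \<le> L"
  shows "1 / B ^ L \<le> dist_nearest_int (B ^ m * expand d)"
proof (rule dist_nearest_int_ge)
  show "B ^ m * expand d - tail d m \<in> \<int>" by (rule power_expand_minus_tail_Ints) fact
  have *: "1 / B ^ L \<le> 1 / B ^ q" if "q \<le> L" for q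
    using that B2 by (intro divide_left_mono power_increasing) auto
  show "1 / B ^ L \<le> tail d m"
    using tail_ge[OF assms(1,2,4)] *[OF assms(6)] by linarith
  show "tail d m \<le> 1 - 1 / B ^ L"
    using tail_le[OF assms(1,3,5)] *[OF assms(7)] by linarith
qed

text \<open>A difference of \<open>1\<close> requires \<open>b - 1\<close> against \<open>0\<close>
  at every place; a single agreement loses at least one unit at that place.\<close>

lemma tail_diff_le:
  assumes "digit_seq d" "digit_seq d'" "d (m + p) = d' (m + p)" "p \<ge> 1"
  shows "\<bar>tail d m - tail d' m\<bar> \<le> 1 - 1 / B ^ p"
  using assms(4,3)
proof (induction p arbitrary: m rule: dec_induct)
  case base
  have "tail d m - tail d' m = (tail d (Suc m) - tail d' (Suc m)) / B"
    using base by (simp add: tail_rec[OF assms(1), of m] tail_rec[OF assms(2), of m] field_simps)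
  moreover have "\<bar>tail d (Suc m) - tail d' (Suc m)\<bar> \<le> 1"
    using tail_le_1[OF assms(1), of "Suc m"] tail_nonneg[OF assms(1), of "Suc m"]
      tail_le_1[OF assms(2), of "Suc m"] tail_nonneg[OF assms(2), of "Suc m"] by linarith
  ultimately have "\<bar>tail d m - tail d' m\<bar> \<le> 1 / B"
    by (simp add: abs_divide divide_right_mono)
  also have "\<dots> \<le> 1 - 1 / B" using B2 by (simp add: field_simps)
  finally show ?case by simp
next
  case (step p)
  have "\<bar>tail d (Suc m) - tail d' (Suc m)\<bar> \<le> 1 - 1 / B ^ p"
    by (rule step.IH) (use step.prems in simp)
  moreover have "\<bar>of_int (d (Suc m)) - of_int (d' (Suc m))\<bar> \<le> B - 1"
    using digit_seq_bounds[OF assms(1), of "Suc m"] digit_seq_bounds[OF assms(2), of "Suc m"] by linarith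
  ultimately have "\<bar>(of_int (d (Suc m)) + tail d (Suc m)) - (of_int (d' (Suc m)) + tail d' (Suc m))\<bar> \<le> B - 1 / B ^ p"
    by linarith
  then have "\<bar>(of_int (d (Suc m)) + tail d (Suc m)) - (of_int (d' (Suc m)) + tail d' (Suc m))\<bar> / B \<le> (B - 1 / B ^ p) / B"
    by (rule divide_right_mono) simp
  also have "(B - 1 / B ^ p) / B = 1 - 1 / B ^ Suc p"
    by (simp add: diff_divide_distrib mult.commute)
  also have "\<bar>(of_int (d (Suc m)) + tail d (Suc m)) - (of_int (d' (Suc m)) + tail d' (Suc m))\<bar> / B = \<bar>tail d m - tail d' m\<bar>"
    by (simp add: tail_rec[OF assms(1), of m] tail_rec[OF assms(2), of m] abs_divide flip: diff_divide_distrib)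
  finally show ?case .
qed

text \<open>The starting position \<open>m\<close> is arbitrary so that induction on
  \<open>q\<close> can strip the common prefix. Once the leading digits differ, they do so by at
  least \<open>1\<close>, and the tails compensate at most \<open>1 - 1 / B ^ p\<close>.\<close>

lemma expand_diff_ge_aux:
  assumes "digit_seq d" "digit_seq d'" "d (m + q) \<noteq> d' (m + q)"
    and "\<And>i. i < q \<Longrightarrow> d (m + i) = d' (m + i)" "d (m + q + p) = d' (m + q + p)" "p \<ge> 1"
  shows "1 / B ^ (q + p) \<le> \<bar>(of_int (d m) + tail d m) - (of_int (d' m) + tail d' m)\<bar>"
  using assms(3-5)
proof (induction q arbitrary: m)
  case 0
  have "1 \<le> \<bar>of_int (d m) - of_int (d' m) :: real\<bar>"
    using 0(1) by (simp flip: of_int_diff of_int_abs) 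
  moreover have "\<bar>tail d m - tail d' m\<bar> \<le> 1 - 1 / B ^ p"
    using 0 by (intro tail_diff_le assms) auto
  ultimately show ?case by simp
next
  case (Suc q)
  have "1 / B ^ (q + p) \<le> \<bar>(of_int (d (Suc m)) + tail d (Suc m)) - (of_int (d' (Suc m)) + tail d' (Suc m))\<bar>"
  proof (rule Suc.IH)
    show "d (Suc m + i) = d' (Suc m + i)" if "i < q" for i
      using Suc.prems(2)[of "Suc i"] that by simp
  qed (use Suc.prems in auto)
  then have "1 / B ^ (q + p) / B \<le> \<bar>(of_int (d (Suc m)) + tail d (Suc m)) - (of_int (d' (Suc m)) + tail d' (Suc m))\<bar> / B"
    by (rule divide_right_mono) simp
  also have "\<dots> = \<bar>(of_int (d m) + tail d m) - (of_int (d' m) + tail d' m)\<bar>"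
    using Suc.prems(2)[of 0]
    by (simp add: tail_rec[OF assms(1), of m] tail_rec[OF assms(2), of m] abs_divide flip: diff_divide_distrib)
  finally show ?case by (simp add: mult.commute)
qed

text \<open>The common digit at position \<open>q + p\<close> rules out long carries.\<close>

lemma expand_diff_ge:
  assumes "digit_seq d" "digit_seq d'" "d q \<noteq> d' q"
    and "\<And>i. i < q \<Longrightarrow> d i = d' i" "d (q + p) = d' (q + p)" "p \<ge> 1"
  shows "1 / B ^ (q + p) \<le> \<bar>expand d - expand d'\<bar>"
  using expand_diff_ge_aux[of d d' 0 q p] assms by (simp add: expand_def)

section \<open>Digits of a given real number\<close>

definition digit :: "real \<Rightarrow> nat \<Rightarrow> int" where
  "digit t i = \<lfloor>B ^ i * t\<rfloor> mod b"

lemma digit_bounds: "0 \<le> digit t i" "digit t i \<le> b - 1"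
  using b2 pos_mod_bound[of b "\<lfloor>B ^ i * t\<rfloor>"] by (auto simp: digit_def)

lemma floor_power_eq_if_digits_eq:
  assumes "\<lfloor>t\<rfloor> = \<lfloor>t'\<rfloor>" "\<And>i. 1 \<le> i \<Longrightarrow> i \<le> r \<Longrightarrow> digit t i = digit t' i"
  shows "\<lfloor>B ^ r * t\<rfloor> = \<lfloor>B ^ r * t'\<rfloor>"
  using assms(2)
proof (induction r)
  case 0
  then show ?case using assms(1) by simp
next
  case (Suc r)
  have *: "\<lfloor>B ^ Suc r * x\<rfloor> = b * \<lfloor>B ^ r * x\<rfloor> + digit x (Suc r)" for x
  proof -
    have "\<lfloor>B ^ Suc r * x\<rfloor> div b = \<lfloor>B ^ Suc r * x / B\<rfloor>"
      by (rule floor_divide_real_eq_div[symmetric]) simp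
    also have "B ^ Suc r * x / B = B ^ r * x" using b2 by simp
    finally show ?thesis
      unfolding digit_def by (metis mult_div_mod_eq)
  qed
  show ?case unfolding * using Suc by simp
qed

lemma abs_diff_le_if_digits_eq:
  assumes "\<lfloor>t\<rfloor> = \<lfloor>t'\<rfloor>" "\<And>i. 1 \<le> i \<Longrightarrow> i \<le> r \<Longrightarrow> digit t i = digit t' i"
  shows "\<bar>t - t'\<bar> \<le> 1 / B ^ r"
proof -
  have "\<lfloor>B ^ r * t\<rfloor> = \<lfloor>B ^ r * t'\<rfloor>"
    using assms by (rule floor_power_eq_if_digits_eq)
  then have "\<bar>B ^ r * t - B ^ r * t'\<bar> \<le> 1" by linarith
  then have "B ^ r * \<bar>t - t'\<bar> \<le> 1"
    by (metis abs_mult abs_of_pos B_pos right_diff_distrib zero_less_power)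
  then show ?thesis by (simp add: field_simps)
qed

lemma digits_differ:
  assumes "\<lfloor>t\<rfloor> = \<lfloor>t'\<rfloor>" "t \<noteq> t'"
  shows "\<exists>i\<ge>1. digit t i \<noteq> digit t' i"
proof (rule ccontr)
  assume "\<not> ?thesis"
  then have "\<bar>t - t'\<bar> \<le> 1 / B ^ r" for r
    using assms(1) by (intro abs_diff_le_if_digits_eq) auto
  moreover have "(\<lambda>r. 1 / B ^ r) \<longlonglongrightarrow> 0"
    using LIMSEQ_inverse_realpow_zero[OF B_gt1] by (simp add: inverse_eq_divide)
  ultimately have "\<bar>t - t'\<bar> \<le> 0" by (intro LIMSEQ_le_const) auto
  then show False using assms(2) by simp
qed

end

section \<open>Inserting digits at free positions\<close>

definition count_upto :: "(nat \<Rightarrow> bool) \<Rightarrow> nat \<Rightarrow> nat" where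
  "count_upto P m = card {i. i \<le> m \<and> P i}"

lemma count_upto_0: "\<not> P 0 \<Longrightarrow> count_upto P 0 = 0"
  by (auto simp: count_upto_def)

lemma count_upto_Suc: "count_upto P (Suc m) = count_upto P m + (if P (Suc m) then 1 else 0)"
proof -
  have "{i. i \<le> Suc m \<and> P i} = (if P (Suc m) then insert (Suc m) {i. i \<le> m \<and> P i} else {i. i \<le> m \<and> P i})"
    by (auto simp: le_Suc_eq)
  then show ?thesis by (auto simp: count_upto_def)
qed

lemma count_upto_mono: "m \<le> n \<Longrightarrow> count_upto P m \<le> count_upto P n"
  unfolding count_upto_def by (intro card_mono) auto

text \<open>With \<open>m = q * G + r\<close>, the full periods contribute
  \<open>q * (G - 2)\<close> and the last one \<open>r - 1\<close> if \<open>r > 0\<close>.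
  Multiplication by \<open>G\<close> keeps the formula in the integers.\<close>

lemma count_upto_mod:
  assumes "2 \<le> G"
  shows "int G * int (count_upto (\<lambda>i. 2 \<le> i mod G) m) =
    (int G - 2) * int m + (if m mod G = 0 then 0 else 2 * int (m mod G) - int G)"
proof (induction m)
  case 0
  then show ?case using count_upto_0[of "\<lambda>i. 2 \<le> i mod G"] by simp
next
  case (Suc m)
  have "m mod G < G" using assms by simp
  consider "Suc (m mod G) = G" "m mod G \<noteq> 0" | "m mod G = 0" "Suc (m mod G) \<noteq> G"
    | "m mod G \<noteq> 0" "Suc (m mod G) \<noteq> G"
    using assms by linarith
  then show ?case
  proof cases
    case 1
    then have "int (m mod G) = int G - 1" by linarith
    with 1 Suc show ?thesis by (simp add: count_upto_Suc mod_Suc algebra_simps)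
  next
    case 2
    with Suc show ?thesis by (simp add: count_upto_Suc mod_Suc algebra_simps)
  next
    case 3
    with Suc show ?thesis by (simp add: count_upto_Suc mod_Suc algebra_simps)
  qed
qed

lemma count_upto_mod_bounds:
  assumes "2 \<le> G"
  shows "\<bar>real (count_upto (\<lambda>i. 2 \<le> i mod G) m) - (1 - 2 / real G) * real m\<bar> \<le> 1"
proof -
  define x where "x = (if m mod G = 0 then 0 else 2 * real (m mod G) - real G)"
  have "m mod G < G" using assms by simp
  then have x: "\<bar>x\<bar> \<le> real G" by (auto simp: x_def)
  have "real G * real (count_upto (\<lambda>i. 2 \<le> i mod G) m) = (real G - 2) * real m + x"
    using arg_cong[OF count_upto_mod[OF assms, of m], of real_of_int] by (auto simp: x_def)
  then have "real (count_upto (\<lambda>i. 2 \<le> i mod G) m) - (1 - 2 / real G) * real m = x / real G"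
    using assms by (simp add: field_simps)
  then show ?thesis using x assms by (simp add: abs_divide)
qed

text \<open>The count differs from its linear approximation by at most \<open>1\<close> at each end
  point, whence the \<open>- 2\<close>.\<close>

lemma count_upto_diff_ge:
  assumes "2 \<le> G" "x \<le> y" "\<And>i. x < i \<Longrightarrow> i \<le> y \<Longrightarrow> P i \<longleftrightarrow> 2 \<le> i mod G"
  shows "real (count_upto P y) \<ge> real (count_upto P x) + (1 - 2 / real G) * (real y - real x) - 2"
proof -
  have "count_upto P y + count_upto (\<lambda>i. 2 \<le> i mod G) x = count_upto P x + count_upto (\<lambda>i. 2 \<le> i mod G) y"
    using assms(2,3)
  proof (induction y rule: dec_induct)
    case (step y)
    then show ?case using step.prems[of "Suc y"] by (auto simp: count_upto_Suc)
  qed simp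
  then have "real (count_upto P y) + real (count_upto (\<lambda>i. 2 \<le> i mod G) x)
      = real (count_upto P x) + real (count_upto (\<lambda>i. 2 \<le> i mod G) y)" by linarith
  then show ?thesis
    using count_upto_mod_bounds[OF assms(1), of x] count_upto_mod_bounds[OF assms(1), of y]
    unfolding right_diff_distrib by linarith
qed

lemma ex_mod_eq_between:
  assumes "\<rho> < G"
  shows "\<exists>x::nat. p < x \<and> x \<le> p + G \<and> x mod G = \<rho>"
proof -
  define q where "q = (p + G - \<rho>) div G"
  have "p + G - \<rho> = q * G + (p + G - \<rho>) mod G"
    unfolding q_def by simp
  moreover have "(p + G - \<rho>) mod G < G" using assms by simp
  ultimately have "p < q * G + \<rho>" "q * G + \<rho> \<le> p + G" using assms by linarith+
  moreover have "(q * G + \<rho>) mod G = \<rho>" using assms by simp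
  ultimately show ?thesis by blast
qed

context base
begin

text \<open>\<open>count_upto P\<close> numbers the free positions from \<open>1\<close>, so the
  digits of \<open>t\<close> after the point are used up in order.\<close>

definition insert_digits :: "(nat \<Rightarrow> bool) \<Rightarrow> (nat \<Rightarrow> int) \<Rightarrow> real \<Rightarrow> nat \<Rightarrow> int" where
  "insert_digits P c t i = (if P i then digit t (count_upto P i) else c i)"

lemma digit_seq_insert_digits:
  "digit_seq c \<Longrightarrow> digit_seq (insert_digits P c t)"
  using digit_bounds by (auto simp: digit_seq_def insert_digits_def)

text \<open>If \<open>t\<close> and \<open>t'\<close> first differ in digit \<open>r\<close>, they
  are at most \<open>B powr (1 - r)\<close> apart. Their images first differ at the
  \<open>r\<close>-th free position \<open>q\<close> and share a digit at most \<open>G\<close>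
  places later, so they are at least \<open>B powr (- (q + G))\<close> apart. The bound
  \<open>r \<ge> s * q - C\<close> compares the two; the constant collects \<open>1\<close>,
  \<open>C\<close> and \<open>s * G\<close>.\<close>

lemma inverse_Hoelder_insert_digits:
  assumes c: "digit_seq c" and P0: "\<not> P 0"
    and gap: "\<And>q. \<exists>p. 1 \<le> p \<and> p \<le> G \<and> \<not> P (q + p)"
    and s: "0 < s" and count: "\<And>m. real (count_upto P m) \<ge> s * real m - C"
    and t: "t \<in> {0..<1}" "t' \<in> {0..<1}"
  shows "\<bar>t - t'\<bar> \<le> B powr (1 + C + s * G) * \<bar>expand (insert_digits P c t) - expand (insert_digits P c t')\<bar> powr s"
proof (cases "t = t'")
  case True
  then show ?thesis by simp
next
  case False
  have fl: "\<lfloor>t\<rfloor> = \<lfloor>t'\<rfloor>" using t floor_unique[of 0 t] floor_unique[of 0 t'] by simp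
  define r where "r = (LEAST i. 1 \<le> i \<and> digit t i \<noteq> digit t' i)"
  have "\<exists>i. 1 \<le> i \<and> digit t i \<noteq> digit t' i" using digits_differ[OF fl False] by blast
  then have r: "1 \<le> r" "digit t r \<noteq> digit t' r"
    unfolding r_def by (metis (mono_tags, lifting) LeastI)+
  have less_r: "digit t i = digit t' i" if "1 \<le> i" "i < r" for i
    using not_less_Least[of i "\<lambda>i. 1 \<le> i \<and> digit t i \<noteq> digit t' i"] that unfolding r_def by auto
  \<comment> \<open>The position of the \<open>r\<close>-th free place; it exists because the linear
    lower bound makes the count unbounded.\<close>
  define q where "q = (LEAST m. r \<le> count_upto P m)"
  obtain m0 :: nat where "real m0 > (real r + C) / s" using reals_Archimedean2 by blast
  then have "s * real m0 - C > real r" using s by (simp add: field_simps)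
  then have "\<exists>m. r \<le> count_upto P m" using count[of m0] by (intro exI[of _ m0]) linarith
  then have q: "r \<le> count_upto P q" unfolding q_def by (rule LeastI_ex)
  have less_q: "count_upto P i < r" if "i < q" for i
    using not_less_Least[of i "\<lambda>m. r \<le> count_upto P m"] that unfolding q_def by auto
  have "q \<noteq> 0"
  proof
    assume "q = 0"
    then show False using q r(1) count_upto_0[of P] P0 by simp
  qed
  then obtain q' where q': "q = Suc q'" using not0_implies_Suc by blast
  have Pq: "P q" and rq: "count_upto P q = r"
    using less_q[of q'] q count_upto_Suc[of P q'] by (auto simp: q' split: if_splits)
  obtain p where p: "1 \<le> p" "p \<le> G" "\<not> P (q + p)" using gap by blast
  define d where "d = insert_digits P c t"
  define d' where "d' = insert_digits P c t'"
  have "1 / B ^ (q + p) \<le> \<bar>expand d - expand d'\<bar>"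
  proof (rule expand_diff_ge)
    show "digit_seq d" "digit_seq d'" using c by (simp_all add: d_def d'_def digit_seq_insert_digits)
    show "d q \<noteq> d' q" using Pq r(2) rq by (simp add: d_def d'_def insert_digits_def)
    show "d (q + p) = d' (q + p)" using p(3) by (simp add: d_def d'_def insert_digits_def)
    show "d i = d' i" if "i < q" for i
    proof (cases "P i")
      case True
      then have "{k. k \<le> i \<and> P k} \<noteq> {}" by blast
      then have "0 < count_upto P i" by (simp add: count_upto_def card_gt_0_iff)
      then show ?thesis using less_r less_q[OF that] by (simp add: d_def d'_def insert_digits_def)
    qed (simp add: d_def d'_def insert_digits_def)
  qed fact
  then have ge: "B powr (- real (q + p)) \<le> \<bar>expand d - expand d'\<bar>"
    by (simp only: powr_minus_nat)
  have "\<bar>t - t'\<bar> \<le> 1 / B ^ (r - 1)"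
    using fl less_r r(1) by (intro abs_diff_le_if_digits_eq) auto
  also have "\<dots> = B powr (- real (r - 1))" by (simp only: powr_minus_nat)
  also have "\<dots> = B powr (1 - real r)" using r(1) by (simp add: of_nat_diff)
  also have "\<dots> \<le> B powr (1 + C + s * G + - real (q + p) * s)"
  proof (intro powr_mono)
    have "s * real p \<le> s * real G" using p s by (intro mult_left_mono) auto
    then show "1 - real r \<le> 1 + C + s * G + - real (q + p) * s"
      using count[of q] unfolding rq by (simp add: algebra_simps)
  qed simp
  also have "\<dots> = B powr (1 + C + s * G) * (B powr (- real (q + p))) powr s"
    by (simp only: powr_add powr_powr)
  also have "\<dots> \<le> B powr (1 + C + s * G) * \<bar>expand d - expand d'\<bar> powr s"
    using ge s by (intro mult_left_mono powr_mono2) auto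
  finally show ?thesis by (simp add: d_def d'_def)
qed

end

section \<open>A Cantor set with prescribed uniform exponent\<close>

text \<open>For records spaced by the constant factor \<open>\<eta> ^ (i + 1)\<close>, the
  proportion of free digits up to the end of a long run of zeros.\<close>

definition block_dim :: "real \<Rightarrow> real \<Rightarrow> nat \<Rightarrow> real" where
  "block_dim \<eta> v i = (\<eta> ^ (i + 1) - 1 - \<eta> ^ i * v) / ((\<eta> ^ (i + 1) - 1) * (1 + \<eta> ^ i * v))"

locale lacunary = base +
  fixes a :: "nat \<Rightarrow> nat" and \<eta> :: real
  assumes mono_a: "strict_mono_on {1..} a"
    and pos_a: "\<And>n. n \<ge> 1 \<Longrightarrow> a n > 0"
    and lim_a: "(\<lambda>n. real (a (n + 1)) / real (a n)) \<longlonglongrightarrow> \<eta>"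
    and eta: "1 < \<eta>"
begin

section \<open>Growth of the sequence\<close>

lemma a_less: "1 \<le> m \<Longrightarrow> m < n \<Longrightarrow> a m < a n"
  using mono_a by (auto simp: strict_mono_on_def)

lemma a_le: "1 \<le> m \<Longrightarrow> m \<le> n \<Longrightarrow> a m \<le> a n"
  using a_less[of m n] by (cases "m = n") auto

lemma a_ge: "1 \<le> n \<Longrightarrow> n \<le> a n"
proof (induction n rule: dec_induct)
  case base
  then show ?case using pos_a[of 1] by simp
next
  case (step n)
  then show ?case using a_less[of n "Suc n"] by simp
qed

lemma a_at_top: "filterlim (\<lambda>n. real (a n)) at_top sequentially"
proof (rule filterlim_at_top_mono)
  show "filterlim real at_top sequentially" by (rule filterlim_real_sequentially)
  show "\<forall>\<^sub>F n in sequentially. real n \<le> real (a n)"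
    using eventually_ge_at_top[of 1] by eventually_elim (simp add: a_ge)
qed

lemma ratio_lim: "(\<lambda>n. real (a (n + l)) / real (a n)) \<longlonglongrightarrow> \<eta> ^ l"
proof (induction l)
  case 0
  have "\<forall>\<^sub>F n in sequentially. 1 = real (a n) / real (a n)"
    using eventually_ge_at_top[of 1] by eventually_elim (use pos_a in force)
  then show ?case by (simp add: tendsto_eventually eventually_mono)
next
  case (Suc l)
  have "(\<lambda>n. real (a (n + 1 + l)) / real (a (n + 1))) \<longlonglongrightarrow> \<eta> ^ l"
    using LIMSEQ_ignore_initial_segment[OF Suc, of 1] by simp
  from tendsto_mult[OF this lim_a]
  have "(\<lambda>n. real (a (n + 1 + l)) / real (a (n + 1)) * (real (a (n + 1)) / real (a n))) \<longlonglongrightarrow> \<eta> ^ Suc l"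
    by (simp add: mult.commute)
  moreover have "\<forall>\<^sub>F n in sequentially. real (a (n + 1 + l)) / real (a (n + 1)) * (real (a (n + 1)) / real (a n))
      = real (a (n + Suc l)) / real (a n)"
    using eventually_ge_at_top[of 1]
  proof eventually_elim
    case (elim n)
    have "a (n + 1) \<noteq> 0" using pos_a[of "n + 1"] by simp
    then show ?case by simp
  qed
  ultimately show ?case by (rule Lim_transform_eventually)
qed

lemma eventually_gap: "\<forall>\<^sub>F n in sequentially. a n + G \<le> a (n + 1)"
proof -
  have "filterlim (\<lambda>n. (real (a (n + 1)) / real (a n) - 1) * real (a n)) at_top sequentially"
    using eta by (intro filterlim_tendsto_pos_mult_at_top[of _ "\<eta> - 1"] tendsto_intros lim_a a_at_top) auto
  then have "\<forall>\<^sub>F n in sequentially. real G \<le> (real (a (n + 1)) / real (a n) - 1) * real (a n)"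
    by (simp add: filterlim_at_top)
  then show ?thesis using eventually_ge_at_top[of 1]
  proof eventually_elim
    case (elim n)
    have "a n > 0" using pos_a elim by simp
    then show ?case using elim(1) by (simp add: algebra_simps)
  qed
qed

definition min_dist :: "real \<Rightarrow> nat \<Rightarrow> real" where
  "min_dist \<xi> N = Min ((\<lambda>n. dist_nearest_int (B ^ a n * \<xi>)) ` {1..N})"

lemma min_dist_le: "1 \<le> n \<Longrightarrow> n \<le> N \<Longrightarrow> min_dist \<xi> N \<le> dist_nearest_int (B ^ a n * \<xi>)"
  unfolding min_dist_def by (intro Min_le) auto

lemma min_dist_attained: "1 \<le> N \<Longrightarrow> \<exists>n\<in>{1..N}. min_dist \<xi> N = dist_nearest_int (B ^ a n * \<xi>)"
proof -
  assume "1 \<le> N"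
  then have "min_dist \<xi> N \<in> (\<lambda>n. dist_nearest_int (B ^ a n * \<xi>)) ` {1..N}"
    unfolding min_dist_def by (intro Min_in) auto
  then show ?thesis by blast
qed

lemma v_hat_eq: "v_hat b a \<xi> = Sup {ereal v | v. 0 \<le> v \<and>
     (\<forall>\<^sub>F N in sequentially. min_dist \<xi> N < B powr (- (v * a N)))}"
proof -
  have "(B ^ a N) powr (- v) = B powr (- (v * a N))" for N v
    by (simp add: powr_powr mult.commute flip: powr_realpow)
  then show ?thesis by (simp add: v_hat_def min_dist_def)
qed

end

text \<open>The records are to be the multiples of \<open>j\<close>. Assumption \<open>u\<close>
  says that a run of zeros, ending near \<open>(1 + \<eta> ^ (j - 1) * v) * A k\<close>, stops well
  before the next record near \<open>\<eta> ^ j * A k\<close>.\<close>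

locale cantor = lacunary +
  fixes v :: real and j :: nat and s :: real
  assumes v_pos: "0 < v" and j: "1 \<le> j" and u: "1 + \<eta> ^ (j - 1) * v < \<eta> ^ j"
    and s: "0 < s" "s < block_dim \<eta> v (j - 1)"
begin

text \<open>\<open>Z k\<close> zeros follow position \<open>A k\<close>; they end at position \<open>M k\<close>.\<close>

definition A :: "nat \<Rightarrow> nat" where "A k = a (k * j)"
text \<open>The index \<open>k * j + (j - 1)\<close> is the last one before the next intended
  record, where the demand on record \<open>k * j\<close> is strongest. The \<open>+ 1\<close> makes
  the resulting inequality strict.\<close>

definition Z :: "nat \<Rightarrow> nat" where "Z k = nat \<lceil>v * a (k * j + (j - 1))\<rceil> + 1"
definition M :: "nat \<Rightarrow> nat" where "M k = A k + Z k"

abbreviation U :: real where "U \<equiv> \<eta> ^ (j - 1)"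

lemma Z_bounds: "v * a (k * j + (j - 1)) + 1 \<le> Z k" "Z k \<le> v * a (k * j + (j - 1)) + 2"
proof -
  have "0 \<le> v * a (k * j + (j - 1))" using v_pos by simp
  then show "v * a (k * j + (j - 1)) + 1 \<le> Z k" "Z k \<le> v * a (k * j + (j - 1)) + 2"
    unfolding Z_def by linarith+
qed

lemma A_pos: "1 \<le> k \<Longrightarrow> 0 < A k"
  unfolding A_def using j by (intro pos_a) simp

lemma A_less: "1 \<le> k \<Longrightarrow> k < k' \<Longrightarrow> A k < A k'"
  unfolding A_def using j by (intro a_less) auto

lemma A_le: "1 \<le> k \<Longrightarrow> k \<le> k' \<Longrightarrow> A k \<le> A k'"
  using A_less[of k k'] by (cases "k = k'") auto

lemma Z_mono: "1 \<le> k \<Longrightarrow> k \<le> k' \<Longrightarrow> Z k \<le> Z k'"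
proof -
  assume k: "1 \<le> k" "k \<le> k'"
  have "a (k * j + (j - 1)) \<le> a (k' * j + (j - 1))"
  proof (rule a_le)
    have "1 * 1 \<le> k * j" using k j by (intro mult_mono) auto
    then show "1 \<le> k * j + (j - 1)" by linarith
    show "k * j + (j - 1) \<le> k' * j + (j - 1)" using k by simp
  qed
  then have "v * a (k * j + (j - 1)) \<le> v * a (k' * j + (j - 1))"
    using v_pos by simp
  then show "Z k \<le> Z k'" unfolding Z_def by (intro add_right_mono nat_mono ceiling_mono)
qed

lemma block_filterlim: "filterlim (\<lambda>k. k * j) at_top sequentially"
  using j by (intro filterlim_subseq) (auto simp: strict_mono_def)

lemma A_at_top: "filterlim (\<lambda>k. real (A k)) at_top sequentially"
  unfolding A_def using filterlim_compose[OF a_at_top block_filterlim] .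

lemma one_over_A: "(\<lambda>k. x / real (A k)) \<longlonglongrightarrow> 0"
  by (rule real_tendsto_divide_at_top[OF tendsto_const A_at_top])

lemma A_lim: "(\<lambda>k. real (A (Suc k)) / real (A k)) \<longlonglongrightarrow> \<eta> ^ j"
proof -
  have "(\<lambda>k. real (a (k * j + j)) / real (a (k * j))) \<longlonglongrightarrow> \<eta> ^ j"
    using filterlim_compose[OF ratio_lim[of j] block_filterlim] .
  then show ?thesis by (simp add: A_def add.commute)
qed

lemma Z_lim: "(\<lambda>k. real (Z k) / real (A k)) \<longlonglongrightarrow> U * v"
proof -
  have *: "(\<lambda>k. v * (real (a (k * j + (j - 1))) / real (A k)) + x / real (A k)) \<longlonglongrightarrow> v * U + 0" for x
    unfolding A_def
    by (intro tendsto_intros filterlim_compose[OF ratio_lim[of "j - 1"] block_filterlim] one_over_A[unfolded A_def])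
  have "(\<lambda>k. real (Z k) / real (A k)) \<longlonglongrightarrow> v * U + 0"
  proof (rule tendsto_sandwich[OF _ _ *[of 1] *[of 2]])
    show "\<forall>\<^sub>F k in sequentially. v * (real (a (k * j + (j - 1))) / real (A k)) + 1 / real (A k) \<le> real (Z k) / real (A k)"
      using Z_bounds(1) by (intro always_eventually allI) (auto simp: divide_right_mono simp flip: add_divide_distrib)
    show "\<forall>\<^sub>F k in sequentially. real (Z k) / real (A k) \<le> v * (real (a (k * j + (j - 1))) / real (A k)) + 2 / real (A k)"
      using Z_bounds(2) by (intro always_eventually allI) (auto simp: divide_right_mono simp flip: add_divide_distrib)
  qed
  then show ?thesis by (simp add: mult.commute)
qed

lemma M_lim: "(\<lambda>k. real (M k) / real (A k)) \<longlonglongrightarrow> 1 + U * v"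
proof -
  have "(\<lambda>k. 1 + real (Z k) / real (A k)) \<longlonglongrightarrow> 1 + U * v"
    by (intro tendsto_intros Z_lim)
  moreover have "\<forall>\<^sub>F k in sequentially. 1 + real (Z k) / real (A k) = real (M k) / real (A k)"
    using eventually_ge_at_top[of 1]
  proof eventually_elim
    case (elim k)
    then show ?case using A_pos[of k] by (simp add: M_def field_simps)
  qed
  ultimately show ?thesis by (rule Lim_transform_eventually)
qed

lemma M_Suc_lim: "(\<lambda>k. real (M (Suc k)) / real (A k)) \<longlonglongrightarrow> (1 + U * v) * \<eta> ^ j"
proof -
  have "(\<lambda>k. real (M (Suc k)) / real (A (Suc k)) * (real (A (Suc k)) / real (A k))) \<longlonglongrightarrow> (1 + U * v) * \<eta> ^ j"
    by (intro tendsto_mult A_lim LIMSEQ_Suc[OF M_lim])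
  then show ?thesis
    using A_pos[of "Suc _"] by simp
qed

text \<open>Turns a strict inequality between limits into one with room for an additive constant,
  such as \<open>G\<close> or the counting error \<open>2\<close>.\<close>

lemma eventually_A_linear:
  assumes "(\<lambda>k. f k / real (A k)) \<longlonglongrightarrow> l" "0 < l"
  shows "\<forall>\<^sub>F k in sequentially. x \<le> f k"
proof -
  have "filterlim (\<lambda>k. f k / real (A k) * real (A k)) at_top sequentially"
    by (intro filterlim_tendsto_pos_mult_at_top[OF assms] A_at_top)
  then have "\<forall>\<^sub>F k in sequentially. x \<le> f k / real (A k) * real (A k)"
    by (simp add: filterlim_at_top)
  then show ?thesis using eventually_ge_at_top[of 1]
    by eventually_elim (use A_pos in force)
qed

lemma Ueta: "\<eta> ^ j = \<eta> * U"
  using j by (cases j) auto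

text \<open>The condition on \<open>s\<close> without denominators. In units of \<open>A k\<close>,
  the left factor is the length from \<open>M k\<close> to \<open>M (Suc k)\<close>, and the right
  side is its part before the next run.\<close>

lemma s_bound: "s * ((1 + U * v) * \<eta> ^ j - (1 + U * v)) < \<eta> ^ j - (1 + U * v)"
proof -
  have "\<eta> ^ j > 1" using eta j by (intro one_less_power) auto
  moreover have "1 + U * v > 0" using eta v_pos by (intro add_pos_pos mult_pos_pos) auto
  ultimately have pos: "0 < (\<eta> ^ j - 1) * (1 + U * v)" by simp
  have "block_dim \<eta> v (j - 1) = (\<eta> ^ j - 1 - U * v) / ((\<eta> ^ j - 1) * (1 + U * v))"
    using j by (simp add: block_dim_def Ueta)
  then have "s * ((\<eta> ^ j - 1) * (1 + U * v)) < \<eta> ^ j - 1 - U * v"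
    using s(2) pos by (simp add: pos_less_divide_eq)
  then show ?thesis by (simp add: algebra_simps)
qed

text \<open>Reserving two residues modulo \<open>G\<close> costs the proportion \<open>2 / G\<close>
  of the available positions; the strictness of \<open>s_bound\<close> pays for it when
  \<open>G\<close> is large.\<close>

lemma ex_G: "\<exists>G::nat. 3 \<le> G \<and> s \<le> 1 - 2 / real G \<and>
  s * ((1 + U * v) * \<eta> ^ j - (1 + U * v)) < (1 - 2 / real G) * (\<eta> ^ j - (1 + U * v))"
proof -
  have lim: "(\<lambda>n. 1 - 2 / real n) \<longlonglongrightarrow> 1 - 0"
    by (intro tendsto_intros lim_const_over_n)
  then have "(\<lambda>n. (1 - 2 / real n) * (\<eta> ^ j - (1 + U * v))) \<longlonglongrightarrow> (1 - 0) * (\<eta> ^ j - (1 + U * v))"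
    by (intro tendsto_intros)
  then have ev1: "\<forall>\<^sub>F n in sequentially. s * ((1 + U * v) * \<eta> ^ j - (1 + U * v)) < (1 - 2 / real n) * (\<eta> ^ j - (1 + U * v))"
    using s_bound by (intro order_tendstoD(1)[where y = "(1 - 0) * (\<eta> ^ j - (1 + U * v))"]) auto
  have "s < 1"
  proof -
    define X where "X = (1 + U * v) * \<eta> ^ j - (1 + U * v)"
    define Y where "Y = \<eta> ^ j - (1 + U * v)"
    have "0 \<le> U * v * \<eta> ^ j" using eta v_pos by simp
    then have "Y \<le> X" unfolding X_def Y_def by (simp add: algebra_simps)
    have "0 < Y" using u by (simp add: Y_def)
    show ?thesis
    proof (rule ccontr)
      assume "\<not> s < 1"
      then have "1 * X \<le> s * X" using \<open>Y \<le> X\<close> \<open>0 < Y\<close> by (intro mult_right_mono) auto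
      then show False using s_bound \<open>Y \<le> X\<close> unfolding X_def[symmetric] Y_def[symmetric] by linarith
    qed
  qed
  with lim have ev2: "\<forall>\<^sub>F n in sequentially. s < 1 - 2 / real n"
    by (intro order_tendstoD(1)[OF lim]) simp
  from ev1 ev2 eventually_ge_at_top[of "3::nat"]
  have "\<forall>\<^sub>F n in sequentially. 3 \<le> n \<and> s \<le> 1 - 2 / real n \<and>
    s * ((1 + U * v) * \<eta> ^ j - (1 + U * v)) < (1 - 2 / real n) * (\<eta> ^ j - (1 + U * v))"
    by eventually_elim simp
  then show ?thesis
    using eventually_happens'[OF sequentially_bot] by blast
qed

text \<open>The distance \<open>G\<close> leaves a full period of residues between a run and the
  next record; the \<open>- 2\<close> absorbs the error of
  \<open>count_upto_diff_ge\<close>.\<close>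

lemma ex_k0:
  assumes G: "s * ((1 + U * v) * \<eta> ^ j - (1 + U * v)) < \<phi> * (\<eta> ^ j - (1 + U * v))"
  shows "\<exists>k0\<ge>1. (\<forall>k\<ge>k0. M k + G \<le> A (Suc k)
      \<and> s * (real (M (Suc k)) - real (M k)) \<le> \<phi> * (real (A (Suc k)) - real (M k)) - 2)
    \<and> (\<forall>n\<ge>k0 * j. a n + G \<le> a (n + 1))"
proof -
  have "\<forall>\<^sub>F k in sequentially. real G \<le> real (A (Suc k)) - real (M k)"
  proof (rule eventually_A_linear)
    have "(\<lambda>k. real (A (Suc k)) / real (A k) - real (M k) / real (A k)) \<longlonglongrightarrow> \<eta> ^ j - (1 + U * v)"
      by (intro tendsto_intros A_lim M_lim)
    then show "(\<lambda>k. (real (A (Suc k)) - real (M k)) / real (A k)) \<longlonglongrightarrow> \<eta> ^ j - (1 + U * v)"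
      by (simp add: diff_divide_distrib)
  qed (use u in simp)
  moreover have "\<forall>\<^sub>F k in sequentially. 2 \<le> \<phi> * (real (A (Suc k)) - real (M k)) - s * (real (M (Suc k)) - real (M k))"
  proof (rule eventually_A_linear)
    have "(\<lambda>k. \<phi> * (real (A (Suc k)) / real (A k) - real (M k) / real (A k))
        - s * (real (M (Suc k)) / real (A k) - real (M k) / real (A k)))
      \<longlonglongrightarrow> \<phi> * (\<eta> ^ j - (1 + U * v)) - s * ((1 + U * v) * \<eta> ^ j - (1 + U * v))"
      by (intro tendsto_intros A_lim M_lim M_Suc_lim)
    then show "(\<lambda>k. (\<phi> * (real (A (Suc k)) - real (M k)) - s * (real (M (Suc k)) - real (M k))) / real (A k))
      \<longlonglongrightarrow> \<phi> * (\<eta> ^ j - (1 + U * v)) - s * ((1 + U * v) * \<eta> ^ j - (1 + U * v))"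
      by (simp only: diff_divide_distrib times_divide_eq_right[symmetric])
  qed (use G in simp)
  ultimately have "\<forall>\<^sub>F k in sequentially. M k + G \<le> A (Suc k)
      \<and> s * (real (M (Suc k)) - real (M k)) \<le> \<phi> * (real (A (Suc k)) - real (M k)) - 2"
    by eventually_elim linarith
  then obtain k1 where k1: "\<And>k. k1 \<le> k \<Longrightarrow> M k + G \<le> A (Suc k)
      \<and> s * (real (M (Suc k)) - real (M k)) \<le> \<phi> * (real (A (Suc k)) - real (M k)) - 2"
    unfolding eventually_sequentially by blast
  obtain n1 where n1: "\<And>n. n1 \<le> n \<Longrightarrow> a n + G \<le> a (n + 1)"
    using eventually_gap[of G] unfolding eventually_sequentially by blast
  have "n1 \<le> n" if "(k1 + n1 + 1) * j \<le> n" for n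
  proof -
    have "n1 * 1 \<le> (k1 + n1 + 1) * j" using j by (intro mult_mono) auto
    with that show ?thesis by simp
  qed
  with k1 n1 show ?thesis by (intro exI[of _ "k1 + n1 + 1"]) auto
qed

end

section \<open>Digit pattern of the Cantor set\<close>

locale cantor_params = cantor +
  fixes G k0 :: nat
  assumes G3: "3 \<le> G" and s_le: "s \<le> 1 - 2 / real G"
    and k0: "1 \<le> k0"
    and M_A: "\<And>k. k0 \<le> k \<Longrightarrow> M k + G \<le> A (Suc k)"
    and growth: "\<And>k. k0 \<le> k \<Longrightarrow>
      s * (real (M (Suc k)) - real (M k)) \<le> (1 - 2 / real G) * (real (A (Suc k)) - real (M k)) - 2"
    and gap: "\<And>n. k0 * j \<le> n \<Longrightarrow> a n + G \<le> a (n + 1)"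
begin

text \<open>Outside the prescribed runs of zeros, the residues \<open>0\<close> and \<open>1\<close> modulo \<open>G\<close> carry the digits
  \<open>1\<close> and \<open>0\<close>, so no further run of equal digits is longer than \<open>G\<close> places. The positions that
  are not free also provide the common digits that exclude long carries.\<close>

definition run :: "nat \<Rightarrow> bool" where "run i \<longleftrightarrow> (\<exists>k\<ge>k0. A k < i \<and> i \<le> M k)"
definition free :: "nat \<Rightarrow> bool" where "free i \<longleftrightarrow> \<not> run i \<and> 2 \<le> i mod G"
definition fixed :: "nat \<Rightarrow> int" where "fixed i = (if \<not> run i \<and> i mod G = 0 then 1 else 0)"
definition point :: "real \<Rightarrow> real" where "point t = expand (insert_digits free fixed t)"

lemma M_less: "k0 \<le> k \<Longrightarrow> M k < M (Suc k)"
  using M_A[of k] G3 unfolding M_def[of "Suc k"] by simp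

lemma M_le:
  assumes "k0 \<le> k" "k \<le> k'"
  shows "M k \<le> M k'"
  using assms(2)
proof (induction k' rule: dec_induct)
  case (step n)
  then show ?case using M_less[of n] assms(1) by simp
qed simp

text \<open>Earlier runs have ended by \<open>M k\<close>, and later ones begin only after
  \<open>A (Suc k)\<close>.\<close>

lemma not_run:
  assumes "k0 \<le> k" "M k < i" "i \<le> A (Suc k)"
  shows "\<not> run i"
proof
  assume "run i"
  then obtain k' where k': "k0 \<le> k'" "A k' < i" "i \<le> M k'" by (auto simp: run_def)
  show False
  proof (cases "k' \<le> k")
    case True then show False using M_le[of k' k] k' assms by simp
  next
    case False then show False using A_le[of "Suc k" k'] k' assms by simp
  qed
qed

lemma digit_seq_fixed: "digit_seq fixed"
  using b2 by (auto simp: digit_seq_def fixed_def)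

lemma count_free_step:
  assumes "k0 \<le> k" "M k \<le> m" "m \<le> A (Suc k)"
  shows "real (count_upto free m) \<ge> real (count_upto free (M k)) + (1 - 2 / real G) * (real m - real (M k)) - 2"
proof (rule count_upto_diff_ge)
  show "free i \<longleftrightarrow> 2 \<le> i mod G" if "M k < i" "i \<le> m" for i
    using not_run[of k i] that assms by (simp add: free_def)
qed (use assms G3 in auto)

text \<open>Telescoping of \<open>growth\<close>: the free positions gained up to
  \<open>A (Suc k)\<close> already pay for the whole way to \<open>M (Suc k)\<close>.\<close>

lemma count_free_M:
  assumes "k0 \<le> k"
  shows "real (count_upto free (M k)) \<ge> s * real (M k) - s * real (M k0)"
  using assms
proof (induction k rule: dec_induct)
  case base
  then show ?case by simp
next
  case (step k)
  have "M k \<le> A (Suc k)" "A (Suc k) \<le> M (Suc k)" using M_A[of k] step by (auto simp: M_def)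
  then have "real (count_upto free (M (Suc k))) \<ge> real (count_upto free (M k)) + (1 - 2 / real G) * (real (A (Suc k)) - real (M k)) - 2"
    using count_free_step[of k "A (Suc k)"] count_upto_mono[of "A (Suc k)" "M (Suc k)" free] step by simp
  then show ?case using growth[of k] step by (simp add: algebra_simps)
qed

lemma M_unbounded: "k0 \<le> k \<Longrightarrow> k - k0 \<le> M k"
proof (induction k rule: dec_induct)
  case (step k)
  then show ?case using M_less[of k] by simp
qed simp

text \<open>The proportion of free positions is critical at the ends \<open>M k\<close> of the runs.
  After such an end it grows at rate \<open>1 - 2 / G \<ge> s\<close>, and inside the next run the
  count reached at its start suffices until its end. The additive constant covers the positions
  before \<open>M k0\<close> and the counting error.\<close>

lemma count_free: "real (count_upto free m) \<ge> s * real m - (s * real (M k0) + 2)"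
proof (cases "m < M k0")
  case True
  then have "s * real m \<le> s * real (M k0)" using s by simp
  then show ?thesis by (simp add: add_increasing)
next
  case False
  define P where "P k \<longleftrightarrow> k0 \<le> k \<and> M k \<le> m" for k
  have "P k0" using False by (simp add: P_def)
  moreover have "\<forall>k. P k \<longrightarrow> id k < m + k0 + 1"
    using M_unbounded by (force simp: P_def)
  ultimately obtain k where k: "P k" "\<And>k'. P k' \<Longrightarrow> k' \<le> k"
    using ex_has_greatest_nat[of P k0 id "m + k0 + 1"] by auto
  have "\<not> P (Suc k)" using k(2)[of "Suc k"] by auto
  with k(1) have *: "k0 \<le> k" "M k \<le> m" "m < M (Suc k)"
    by (auto simp: P_def)
  show ?thesis
  proof (cases "m \<le> A (Suc k)")
    case True
    have "s * (real m - real (M k)) \<le> (1 - 2 / real G) * (real m - real (M k))"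
      using s_le * by (intro mult_right_mono) auto
    then show ?thesis
      using count_free_step[of k m] count_free_M[of k] * True by (simp add: algebra_simps)
  next
    case False
    have "M k \<le> A (Suc k)" using M_A[of k] * by simp
    then have "real (count_upto free (A (Suc k))) \<ge> s * real (M (Suc k)) - s * real (M k0)"
      using count_free_step[of k "A (Suc k)"] count_free_M[of k] growth[of k] * by (simp add: algebra_simps)
    moreover have "s * real m \<le> s * real (M (Suc k))" using * s by simp
    moreover have "count_upto free (A (Suc k)) \<le> count_upto free m"
      using False by (intro count_upto_mono) simp
    ultimately show ?thesis by linarith
  qed
qed

lemma point_inverse_Hoelder:
  assumes "t \<in> {0..<1}" "t' \<in> {0..<1}"
  shows "\<bar>t - t'\<bar> \<le> B powr (1 + (s * real (M k0) + 2) + s * G) * \<bar>point t - point t'\<bar> powr s"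
  unfolding point_def
proof (intro inverse_Hoelder_insert_digits digit_seq_fixed count_free assms)
  show "\<not> free 0" by (simp add: free_def)
  show "\<exists>p. 1 \<le> p \<and> p \<le> G \<and> \<not> free (q + p)" for q
  proof -
    obtain x where "q < x" "x \<le> q + G" "x mod G = 0"
      using ex_mod_eq_between[of 0 G q] G3 by auto
    then show ?thesis by (intro exI[of _ "x - q"]) (auto simp: free_def)
  qed
qed (use s in auto)

lemma digit_seq_point: "digit_seq (insert_digits free fixed t)"
  by (intro digit_seq_insert_digits digit_seq_fixed)

text \<open>The multiple of \<open>j\<close> just below \<open>N\<close> is a witness, as its run
  was sized for the last index of the block.\<close>

lemma min_dist_point_less:
  assumes "k0 * j \<le> N"
  shows "min_dist (point t) N < B powr (- (v * a N))"
proof -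
  define k where "k = N div j"
  have k: "k0 \<le> k" "k * j \<le> N" "N \<le> k * j + (j - 1)"
  proof -
    show "k0 \<le> k" unfolding k_def using assms j by (simp add: less_eq_div_iff_mult_less_eq)
    have "N = k * j + N mod j" by (simp add: k_def)
    moreover have "N mod j < j" using j by simp
    ultimately show "k * j \<le> N" "N \<le> k * j + (j - 1)" by linarith+
  qed
  have "1 * 1 \<le> k * j" using k(1) k0 j by (intro mult_mono) auto
  then have kj: "1 \<le> k * j" by simp
  have "min_dist (point t) N \<le> dist_nearest_int (B ^ a (k * j) * point t)"
    using kj k by (intro min_dist_le)
  also have "\<dots> \<le> 1 / B ^ Z k"
    unfolding point_def A_def[symmetric]
  proof (intro dist_nearest_int_expand_le digit_seq_point)
    fix i assume "A k < i" "i \<le> A k + Z k"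
    then have "run i" using k by (auto simp: run_def M_def)
    then show "insert_digits free fixed t i = 0"
      by (simp add: insert_digits_def free_def fixed_def)
  qed
  also have "\<dots> = B powr (- real (Z k))"
    by (simp only: powr_minus_nat)
  also have "\<dots> < B powr (- (v * a N))"
  proof (intro powr_less_mono)
    have "a N \<le> a (k * j + (j - 1))" using order.trans[OF kj k(2)] k(3) by (intro a_le)
    then have "v * a N \<le> v * a (k * j + (j - 1))" using v_pos by simp
    then show "- real (Z k) < - (v * a N)" using Z_bounds(1)[of k] by simp
  qed simp
  finally show ?thesis .
qed

text \<open>Past \<open>p\<close>, the later of position \<open>a n\<close> and the end of the
  current run, a full period lies outside all runs and so shows both a \<open>1\<close> and a
  \<open>0\<close>. As \<open>p \<le> a n + Z k\<close>, both occur within \<open>Z k + G\<close>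
  places of \<open>a n\<close>.\<close>

lemma dist_point_ge:
  assumes k: "k0 \<le> k" "M k0 \<le> Z k" and n: "1 \<le> n" "n \<le> k * j + (j - 1)"
  shows "1 / B ^ (Z k + G) \<le> dist_nearest_int (B ^ a n * point t)"
proof -
  \<comment> \<open>The block of \<open>n\<close>, or the first block for indices before it; in the
    latter case \<open>M k0 \<le> Z k\<close> bounds \<open>p\<close>.\<close>
  define i where "i = max k0 (n div j)"
  define p where "p = max (a n) (M i)"
  have "n div j \<le> k"
  proof -
    have "n < Suc k * j" using n(2) j by simp
    then have "n div j < Suc k" using j by (simp add: div_less_iff_less_mult)
    then show ?thesis by simp
  qed
  then have i: "k0 \<le> i" "i \<le> k" using k by (auto simp: i_def)
  have p1: "p + G \<le> A (Suc i)"
  proof -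
    have "a n + G \<le> A (Suc i)"
    proof (cases "n < k0 * j")
      case True
      have "a n \<le> a (k0 * j)" using n True by (intro a_le) auto
      also have "\<dots> \<le> M k0" by (simp add: M_def A_def)
      also have "\<dots> \<le> M i" using i by (intro M_le) auto
      finally show ?thesis using M_A[OF i(1)] by simp
    next
      case False
      have "n div j \<le> i" by (simp add: i_def)
      then have "n < Suc i * j" using j by (metis div_less_iff_less_mult le_imp_less_Suc less_le_trans zero_less_one)
      then have "a (n + 1) \<le> A (Suc i)" unfolding A_def by (intro a_le) auto
      then show ?thesis using gap[of n] False by simp
    qed
    then show ?thesis using M_A[OF i(1)] by (auto simp: p_def)
  qed
  have p2: "p \<le> a n + Z k"
  proof (cases "n < k0 * j")
    case True
    then have "n div j < k0" using j by (simp add: div_less_iff_less_mult)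
    then have i: "i = k0" by (simp add: i_def)
    then show ?thesis using k by (simp add: p_def)
  next
    case False
    then have "k0 \<le> n div j" using j by (simp add: less_eq_div_iff_mult_less_eq)
    then have i': "i = n div j" by (simp add: i_def)
    then have "A i \<le> a n" unfolding A_def using i k0 j by (intro a_le) auto
    moreover have "Z i \<le> Z k" using i k0 by (intro Z_mono) auto
    ultimately show ?thesis by (simp add: p_def M_def)
  qed
  obtain x where x: "p < x" "x \<le> p + G" "x mod G = 0" using ex_mod_eq_between[of 0 G p] G3 by auto
  obtain y where y: "p < y" "y \<le> p + G" "y mod G = 1" using ex_mod_eq_between[of 1 G p] G3 by auto
  have nr: "\<not> run z" if "p < z" "z \<le> p + G" for z
    using not_run[OF i(1), of z] that p1 by (simp add: p_def)
  have "p \<ge> a n" by (simp add: p_def)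
  then have "1 / B ^ (Z k + G) \<le> dist_nearest_int (B ^ a n * expand (insert_digits free fixed t))"
    using x y nr[OF x(1,2)] nr[OF y(1,2)] p2
    by (intro dist_nearest_int_expand_ge[where p = "x - a n" and p' = "y - a n"] digit_seq_point)
       (auto simp: insert_digits_def free_def fixed_def)
  then show ?thesis by (simp add: point_def)
qed

lemma v_hat_point: "v_hat b a (point t) = ereal v"
proof (rule antisym)
  show "ereal v \<le> v_hat b a (point t)"
  proof -
    have "\<forall>\<^sub>F N in sequentially. min_dist (point t) N < B powr - (v * a N)"
      using eventually_ge_at_top[of "k0 * j"] by eventually_elim (rule min_dist_point_less)
    with less_imp_le[OF v_pos] show ?thesis
      unfolding v_hat_eq by (intro Sup_upper) blast
  qed
  show "v_hat b a (point t) \<le> ereal v"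
    unfolding v_hat_eq
  proof (intro Sup_least, clarify)
    fix w :: real assume ev: "\<forall>\<^sub>F N in sequentially. min_dist (point t) N < B powr - (w * a N)"
    show "ereal w \<le> ereal v"
    proof (rule ccontr)
      assume "\<not> ereal w \<le> ereal v"
      then have w: "v < w" by simp
      obtain N0 where N0: "\<And>N. N0 \<le> N \<Longrightarrow> min_dist (point t) N < B powr - (w * a N)"
        using ev unfolding eventually_sequentially by blast
      \<comment> \<open>The \<open>2\<close> is the rounding in \<open>Z\<close>, and
        \<open>G\<close> is the loss in \<open>dist_point_ge\<close>; \<open>a N > x\<close> lets
        \<open>(w - v) * a N\<close> exceed their sum.\<close>
      define x where "x = (2 + real G) / (w - v)"
      obtain k1 :: nat where k1: "x < real k1" using reals_Archimedean2 by blast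
      obtain k2 :: nat where k2: "real (M k0) / v < real k2" using reals_Archimedean2 by blast
      define k where "k = k0 + N0 + k1 + k2"
      \<comment> \<open>At the last index of a block the length of the run is exhausted up to a
        constant.\<close>
      define N where "N = k * j + (j - 1)"
      have "k * 1 \<le> k * j" using j by (intro mult_mono) auto
      then have kN: "k \<le> N" unfolding N_def by linarith
      then have N: "1 \<le> N" "N0 \<le> N" "k0 \<le> k" "k \<le> a N"
        using k0 a_ge[of N] by (auto simp: k_def)
      have "real (M k0) < v * k2" using k2 v_pos by (simp add: field_simps)
      also have "\<dots> \<le> v * a N" using N(4) less_imp_le[OF v_pos] by (intro mult_left_mono) (auto simp: k_def)
      finally have "M k0 \<le> Z k" using Z_bounds(1)[of k] unfolding N_def by linarith
      obtain n where n: "n \<in> {1..N}" "min_dist (point t) N = dist_nearest_int (B ^ a n * point t)"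
        using min_dist_attained[OF N(1)] by blast
      have "B powr (- real (Z k + G)) = 1 / B ^ (Z k + G)"
        by (rule powr_minus_nat)
      also have "\<dots> \<le> min_dist (point t) N"
        unfolding n(2) using n(1) N \<open>M k0 \<le> Z k\<close> by (intro dist_point_ge) (auto simp: N_def)
      also have "\<dots> < B powr - (w * a N)" using N0 N by simp
      finally have "- real (Z k + G) < - (w * a N)" by (simp add: powr_less_cancel_iff)
      then have "(w - v) * a N < 2 + G"
        using Z_bounds(2)[of k] by (simp add: N_def algebra_simps)
      moreover have "2 + real G < (w - v) * a N"
      proof -
        have "2 + real G < (w - v) * k1" using k1 w by (simp add: x_def field_simps)
        also have "\<dots> \<le> (w - v) * a N" using N(4) w by (simp add: k_def)
        finally show ?thesis .
      qed
      ultimately show False by simp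
    qed
  qed
qed

lemma hausdorff_measure_V_star_set_ne_0: "hausdorff_measure s (V_star_set b a v) \<noteq> 0"
proof (rule hausdorff_measure_pos_if_inverse_Hoelder[where g = point])
  show "0 < B powr (1 + (s * real (M k0) + 2) + s * G)" by simp
  show "point t \<in> V_star_set b a v" for t by (simp add: V_star_set_def v_hat_point)
qed (use s point_inverse_Hoelder in blast)+

end

context cantor
begin

lemma hausdorff_measure_V_star_set_ne_0:
  "hausdorff_measure s (V_star_set b a v) \<noteq> 0" and V_star_set_nonempty: "V_star_set b a v \<noteq> {}"
proof -
  obtain G where G: "3 \<le> G" "s \<le> 1 - 2 / real G"
    "s * ((1 + U * v) * \<eta> ^ j - (1 + U * v)) < (1 - 2 / real G) * (\<eta> ^ j - (1 + U * v))"
    using ex_G by blast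
  obtain k0 where "1 \<le> k0"
    "\<forall>k\<ge>k0. M k + G \<le> A (Suc k)
      \<and> s * (real (M (Suc k)) - real (M k)) \<le> (1 - 2 / real G) * (real (A (Suc k)) - real (M k)) - 2"
    "\<forall>n\<ge>k0 * j. a n + G \<le> a (n + 1)"
    using ex_k0[OF G(3), of G] by blast
  then interpret cantor_params b a \<eta> v j s G k0
    using G by unfold_locales auto
  show "hausdorff_measure s (V_star_set b a v) \<noteq> 0" by (rule hausdorff_measure_V_star_set_ne_0)
  have "point 0 \<in> V_star_set b a v" using v_hat_point by (simp add: V_star_set_def)
  then show "V_star_set b a v \<noteq> {}" by blast
qed

end

section \<open>Covering by records\<close>

lemma card_int_abs_diff_le:
  fixes x R :: real
  assumes "0 \<le> R"
  shows "finite {p::int. \<bar>of_int p - x\<bar> \<le> R}" "real (card {p::int. \<bar>of_int p - x\<bar> \<le> R}) \<le> 2 * R + 1"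
proof -
  have sub: "{p::int. \<bar>of_int p - x\<bar> \<le> R} \<subseteq> {\<lceil>x - R\<rceil>..\<lfloor>x + R\<rfloor>}"
    by (auto simp: ceiling_le_iff le_floor_iff)
  then show "finite {p::int. \<bar>of_int p - x\<bar> \<le> R}" by (rule finite_subset) simp
  have "card {p::int. \<bar>of_int p - x\<bar> \<le> R} \<le> nat (\<lfloor>x + R\<rfloor> - \<lceil>x - R\<rceil> + 1)"
    using card_mono[OF _ sub] by simp
  then show "real (card {p::int. \<bar>of_int p - x\<bar> \<le> R}) \<le> 2 * R + 1"
    using assms by linarith
qed

context lacunary
begin

text \<open>The gap between \<open>z\<close> and \<open>E\<close> absorbs every constant factor, so
  the recursion below only has to compare limits of exponents strictly.\<close>

lemma eventually_le_powr:
  assumes "(\<lambda>n. e n / real (a n)) \<longlonglongrightarrow> E" "z < E" "0 < K"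
  shows "\<forall>\<^sub>F n in sequentially. K * B powr (- e n) \<le> B powr (- (z * a n))"
proof -
  have "(\<lambda>n. e n / real (a n) - z) \<longlonglongrightarrow> E - z"
    by (intro tendsto_intros assms)
  then have "filterlim (\<lambda>n. (e n / real (a n) - z) * real (a n)) at_top sequentially"
    using assms(2) by (intro filterlim_tendsto_pos_mult_at_top[OF _ _ a_at_top]) auto
  then have "\<forall>\<^sub>F n in sequentially. log B K \<le> (e n / real (a n) - z) * real (a n)"
    by (simp add: filterlim_at_top)
  then show ?thesis using eventually_ge_at_top[of 1]
  proof eventually_elim
    case (elim n)
    have "real (a n) > 0" using pos_a elim by simp
    then have "log B K - e n \<le> - (z * a n)" using elim(1) by (simp add: algebra_simps)
    have "K * B powr (- e n) = B powr (log B K) * B powr (- e n)"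
      using assms(3) by (simp add: powr_log_cancel)
    also have "\<dots> = B powr (log B K - e n)" by (simp flip: powr_add)
    also have "\<dots> \<le> B powr (- (z * a n))" using \<open>log B K - e n \<le> _\<close> by (intro powr_mono) auto
    finally show ?case .
  qed
qed

section \<open>Records and the points attached to them\<close>

definition is_record :: "real \<Rightarrow> nat \<Rightarrow> bool" where
  "is_record \<xi> n \<longleftrightarrow> 1 \<le> n \<and> (\<forall>m. 1 \<le> m \<longrightarrow> m < n \<longrightarrow>
     dist_nearest_int (B ^ a n * \<xi>) < dist_nearest_int (B ^ a m * \<xi>))"

text \<open>Irrationality keeps all distances positive, so records never stop. Fixing
  \<open>N0\<close> turns the asymptotic condition into a countable union.\<close>

definition approx_set :: "real \<Rightarrow> nat \<Rightarrow> real set" where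
  "approx_set v N0 = {\<xi>. \<xi> \<notin> \<rat> \<and> (\<forall>N\<ge>N0. min_dist \<xi> N < B powr (- (v * a N)))}"

text \<open>For a tie between two nearest integers the point lies in two of these sets, which is
  harmless for covers.\<close>

definition near_set :: "real \<Rightarrow> nat \<Rightarrow> nat \<Rightarrow> int \<Rightarrow> real set" where
  "near_set v N0 n p = {\<xi> \<in> approx_set v N0. is_record \<xi> n \<and>
     dist_nearest_int (B ^ a n * \<xi>) = \<bar>B ^ a n * \<xi> - of_int p\<bar>}"

lemma dist_pos_irrational:
  assumes "\<xi> \<notin> \<rat>"
  shows "0 < dist_nearest_int (B ^ m * \<xi>)"
proof -
  obtain p where p: "dist_nearest_int (B ^ m * \<xi>) = \<bar>B ^ m * \<xi> - of_int p\<bar>"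
    using dist_nearest_int_attained by blast
  have "B ^ m * \<xi> \<noteq> of_int p"
  proof
    assume "B ^ m * \<xi> = of_int p"
    then have "\<xi> = of_int p / of_int (b ^ m)" by (simp add: field_simps)
    then show False using assms by simp
  qed
  then show ?thesis using p by simp
qed

text \<open>The minimum \<rho> over an initial segment is positive but is eventually undercut; the
  first index that undercuts it is a record beyond the segment.\<close>

lemma ex_record:
  assumes "\<xi> \<in> approx_set v N0" "0 < v"
  shows "\<exists>n>N. is_record \<xi> n"
proof -
  \<comment> \<open>\<open>Suc N\<close> keeps the range of the minimum nonempty for
    \<open>N = 0\<close>.\<close>
  define \<rho> where "\<rho> = min_dist \<xi> (Suc N)"
  obtain m where "m \<in> {1..Suc N}" "\<rho> = dist_nearest_int (B ^ a m * \<xi>)"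
    using min_dist_attained[of "Suc N" \<xi>] by (auto simp: \<rho>_def)
  then have "0 < \<rho>" using assms(1) dist_pos_irrational by (auto simp: approx_set_def)
  have "(\<lambda>N. v * a N / real (a N)) \<longlonglongrightarrow> v"
  proof (rule tendsto_eventually)
    show "\<forall>\<^sub>F n in sequentially. v * a n / real (a n) = v"
      using eventually_ge_at_top[of 1] by eventually_elim (use pos_a in force)
  qed
  from eventually_le_powr[OF this assms(2), of "1 / \<rho>"]
  have "\<forall>\<^sub>F N in sequentially. B powr (- (v * a N)) \<le> \<rho>"
    using \<open>0 < \<rho>\<close> by (simp add: field_simps)
  with eventually_ge_at_top[of N0] eventually_ge_at_top[of 1]
  have "\<forall>\<^sub>F N in sequentially. N0 \<le> N \<and> 1 \<le> N \<and> B powr (- (v * a N)) \<le> \<rho>"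
    by eventually_elim simp
  then obtain N' where "N0 \<le> N'" "1 \<le> N'" "B powr (- (v * a N')) \<le> \<rho>"
    using eventually_happens'[OF sequentially_bot] by blast
  then have "min_dist \<xi> N' < \<rho>" using assms(1) by (force simp: approx_set_def)
  then have ex: "\<exists>n. 1 \<le> n \<and> dist_nearest_int (B ^ a n * \<xi>) < \<rho>"
    using min_dist_attained[OF \<open>1 \<le> N'\<close>, of \<xi>] by auto
  define n where "n = (LEAST n. 1 \<le> n \<and> dist_nearest_int (B ^ a n * \<xi>) < \<rho>)"
  have n: "1 \<le> n" "dist_nearest_int (B ^ a n * \<xi>) < \<rho>"
    using LeastI_ex[OF ex] by (auto simp: n_def)
  have less: "\<rho> \<le> dist_nearest_int (B ^ a m * \<xi>)" if "1 \<le> m" "m < n" for m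
    using not_less_Least[of m "\<lambda>n. 1 \<le> n \<and> dist_nearest_int (B ^ a n * \<xi>) < \<rho>"] that
    by (auto simp: n_def)
  have "is_record \<xi> n" using n less by (fastforce simp: is_record_def)
  moreover have "n > N"
  proof (rule ccontr)
    assume "\<not> n > N"
    then show False using min_dist_le[of n "Suc N" \<xi>] n by (simp add: \<rho>_def)
  qed
  ultimately show ?thesis by blast
qed

text \<open>The first index beyond \<open>n\<close> with a smaller distance would itself be a
  record.\<close>

lemma record_le:
  assumes "is_record \<xi> n" "\<And>m. n < m \<Longrightarrow> m < n' \<Longrightarrow> \<not> is_record \<xi> m"
  shows "1 \<le> m \<Longrightarrow> m < n' \<Longrightarrow> dist_nearest_int (B ^ a n * \<xi>) \<le> dist_nearest_int (B ^ a m * \<xi>)"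
proof (induction m rule: less_induct)
  case (less m)
  show ?case
  proof (rule ccontr)
    assume c: "\<not> ?case"
    have "n < m"
    proof (rule ccontr)
      assume "\<not> n < m"
      then show False using assms(1) c less.prems by (cases "m = n") (auto simp: is_record_def)
    qed
    moreover have "is_record \<xi> m"
      unfolding is_record_def
    proof (intro conjI allI impI)
      fix i assume "1 \<le> i" "i < m"
      then show "dist_nearest_int (B ^ a m * \<xi>) < dist_nearest_int (B ^ a i * \<xi>)"
        using less.IH[of i] less.prems c by auto
    qed (use less.prems in simp)
    ultimately show False using assms(2) less.prems by blast
  qed
qed

lemma min_dist_eq_record:
  assumes "is_record \<xi> n" "\<And>m. n < m \<Longrightarrow> m \<le> N \<Longrightarrow> \<not> is_record \<xi> m" "n \<le> N"
  shows "min_dist \<xi> N = dist_nearest_int (B ^ a n * \<xi>)"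
proof (rule antisym)
  have n1: "1 \<le> n" using assms(1) by (simp add: is_record_def)
  show "min_dist \<xi> N \<le> dist_nearest_int (B ^ a n * \<xi>)"
    using n1 assms(3) by (rule min_dist_le)
  obtain m where m: "m \<in> {1..N}" "min_dist \<xi> N = dist_nearest_int (B ^ a m * \<xi>)"
    using min_dist_attained[of N \<xi>] n1 assms(3) by auto
  show "dist_nearest_int (B ^ a n * \<xi>) \<le> min_dist \<xi> N"
    unfolding m(2) using m(1) assms(2) by (intro record_le[OF assms(1), of "Suc N"]) auto
qed

text \<open>The exponent of the radius of the ball around \<open>p / B ^ a n\<close> that is forced
  when no record occurs from \<open>n + 1\<close> to \<open>n + i\<close>.\<close>

definition depth :: "real \<Rightarrow> nat \<Rightarrow> nat \<Rightarrow> real" where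
  "depth v n i = real (a n) + v * real (a (n + i))"

lemma near_set_subset_ball:
  assumes "\<xi> \<in> near_set v N0 n p" "\<And>m. n < m \<Longrightarrow> m \<le> n + i \<Longrightarrow> \<not> is_record \<xi> m" "N0 \<le> n"
  shows "\<bar>\<xi> - of_int p / B ^ a n\<bar> \<le> B powr (- depth v n i)"
proof -
  have "\<bar>B ^ a n * \<xi> - of_int p\<bar> = min_dist \<xi> (n + i)"
    using assms(1,2) min_dist_eq_record[of \<xi> n "n + i"] by (auto simp: near_set_def)
  also have "\<dots> \<le> B powr (- (v * a (n + i)))"
    using assms(1) trans_le_add1[OF assms(3)]
    by (intro less_imp_le) (auto simp: near_set_def approx_set_def)
  finally have *: "\<bar>B ^ a n * \<xi> - of_int p\<bar> \<le> B powr (- (v * a (n + i)))" .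
  have "\<xi> - of_int p / B ^ a n = (B ^ a n * \<xi> - of_int p) / B ^ a n"
    by (simp add: field_simps)
  then have "\<bar>\<xi> - of_int p / B ^ a n\<bar> = \<bar>B ^ a n * \<xi> - of_int p\<bar> / B ^ a n"
    by (simp add: abs_divide)
  also have "\<dots> \<le> B powr (- (v * a (n + i))) / B ^ a n"
    using * by (intro divide_right_mono) auto
  also have "\<dots> = B powr (- (v * a (n + i))) * B powr (- real (a n))"
    by (simp only: powr_minus_nat) simp
  also have "\<dots> = B powr (- depth v n i)"
    unfolding powr_add[symmetric] depth_def by (rule arg_cong[where f = "(powr) B"]) simp
  finally show ?thesis .
qed

definition next_set :: "real \<Rightarrow> nat \<Rightarrow> nat \<Rightarrow> int \<Rightarrow> nat \<Rightarrow> real set" where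
  "next_set v N0 n p i = {\<xi> \<in> near_set v N0 n p. \<forall>m. n < m \<longrightarrow> m \<le> n + i \<longrightarrow> \<not> is_record \<xi> m}"

text \<open>The split is by the first record after \<open>n\<close>; all long waiting times are
  lumped into one piece, for which a single ball will do.\<close>

lemma near_set_subset_next:
  "near_set v N0 n p \<subseteq>
    (\<Union>i\<in>{..<L}. next_set v N0 n p i \<inter> {\<xi>. is_record \<xi> (n + i + 1)}) \<union> next_set v N0 n p L"
proof
  fix \<xi> assume \<xi>: "\<xi> \<in> near_set v N0 n p"
  show "\<xi> \<in> (\<Union>i\<in>{..<L}. next_set v N0 n p i \<inter> {\<xi>. is_record \<xi> (n + i + 1)}) \<union> next_set v N0 n p L"
  proof (cases "\<exists>i. i < L \<and> is_record \<xi> (n + i + 1)")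
    case False
    have "\<not> is_record \<xi> m" if "n < m" "m \<le> n + L" for m
    proof -
      have "m = n + (m - n - 1) + 1" "m - n - 1 < L" using that by auto
      then show ?thesis using False by metis
    qed
    then show ?thesis using \<xi> by (simp add: next_set_def)
  next
    case True
    define i where "i = (LEAST i. i < L \<and> is_record \<xi> (n + i + 1))"
    have i: "i < L" "is_record \<xi> (n + i + 1)" using LeastI_ex[OF True] by (auto simp: i_def)
    have "\<not> is_record \<xi> m" if m: "n < m" "m \<le> n + i" for m
    proof -
      have *: "m = n + (m - n - 1) + 1" "m - n - 1 < i" using m by auto
      then have "\<not> (m - n - 1 < L \<and> is_record \<xi> (n + (m - n - 1) + 1))"
        unfolding i_def by (intro not_less_Least)
      then show ?thesis using * i(1) by simp
    qed
    then show ?thesis using \<xi> i by (auto simp: next_set_def)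
  qed
qed

lemma next_set_premeasure_ball:
  assumes "0 < s" "N0 \<le> n" "2 * B powr (- depth v n i) \<le> \<delta>"
  shows "hausdorff_premeasure \<delta> s (next_set v N0 n p i) \<le> ennreal (2 powr s * B powr (- (s * depth v n i)))"
proof -
  have "next_set v N0 n p i \<subseteq> {\<xi>. \<bar>\<xi> - of_int p / B ^ a n\<bar> \<le> B powr (- depth v n i)}"
    using assms(2) by (auto simp: next_set_def intro!: near_set_subset_ball)
  then have "hausdorff_premeasure \<delta> s (next_set v N0 n p i) \<le>
     hausdorff_premeasure \<delta> s {\<xi>. \<bar>\<xi> - of_int p / B ^ a n\<bar> \<le> B powr (- depth v n i)}"
    by (rule hausdorff_premeasure_mono)
  also have "\<dots> \<le> ennreal ((2 * B powr (- depth v n i)) powr s)"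
    using assms by (intro hausdorff_premeasure_cball_le) auto
  also have "(2 * B powr (- depth v n i)) powr s = 2 powr s * B powr (- (s * depth v n i))"
    by (simp add: powr_mult powr_powr mult.commute)
  finally show ?thesis .
qed

lemma near_set_ball0:
  assumes "\<xi> \<in> near_set v N0 n p"
  shows "\<bar>B ^ a n * \<xi> - of_int p\<bar> \<le> 1"
proof -
  have "dist_nearest_int (B ^ a n * \<xi>) \<le> \<bar>B ^ a n * \<xi> - of_int \<lfloor>B ^ a n * \<xi>\<rfloor>\<bar>"
    by (rule dist_nearest_int_le)
  also have "\<dots> \<le> 1" by linarith
  finally show ?thesis using assms by (simp add: near_set_def)
qed

text \<open>The ball around \<open>p / B ^ a n\<close> of radius \<open>B powr (- depth v n i)\<close> contains at most
  \<open>2 X + 3\<close> candidates \<open>p' / B ^ a n'\<close> for the next record, where \<open>X = B powr (a n' - depth v n i)\<close>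
  may be less than \<open>1\<close>; hence the minimum of two exponents.\<close>

lemma next_set_premeasure_children:
  fixes y :: real
  assumes "0 < \<delta>" "N0 \<le> n"
    and IH: "\<And>p'. hausdorff_premeasure \<delta> s (near_set v N0 (n + i + 1) p') \<le> ennreal (B powr (- (y * a (n + i + 1))))"
  shows "hausdorff_premeasure \<delta> s (next_set v N0 n p i \<inter> {\<xi>. is_record \<xi> (n + i + 1)}) \<le>
    ennreal (5 * B powr (- min (y * a (n + i + 1)) (y * a (n + i + 1) - a (n + i + 1) + depth v n i)))"
proof -
  define n' where "n' = n + i + 1"
  define X where "X = B powr (a n' - depth v n i)"
  \<comment> \<open>The extra \<open>1\<close> is the distance from \<open>B ^ a n' * \<xi>\<close>
    to its nearest integer.\<close>
  define R where "R = X + 1"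
  define x where "x = B ^ a n' * (of_int p / B ^ a n)"
  define Q where "Q = {p'::int. \<bar>of_int p' - x\<bar> \<le> R}"
  have X0: "0 \<le> X" by (simp add: X_def)
  have Q: "finite Q" "real (card Q) \<le> 2 * R + 1"
    using card_int_abs_diff_le[of R x] X0 by (auto simp: Q_def R_def)
  have "next_set v N0 n p i \<inter> {\<xi>. is_record \<xi> n'} \<subseteq> (\<Union>p'\<in>Q. near_set v N0 n' p')"
  proof
    fix \<xi> assume \<xi>: "\<xi> \<in> next_set v N0 n p i \<inter> {\<xi>. is_record \<xi> n'}"
    obtain p' where p': "dist_nearest_int (B ^ a n' * \<xi>) = \<bar>B ^ a n' * \<xi> - of_int p'\<bar>"
      using dist_nearest_int_attained by blast
    have near: "\<xi> \<in> near_set v N0 n' p'"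
      using \<xi> p' by (auto simp: near_set_def next_set_def)
    have "\<bar>\<xi> - of_int p / B ^ a n\<bar> \<le> B powr (- depth v n i)"
      using \<xi> assms(2) by (auto simp: next_set_def intro!: near_set_subset_ball)
    then have "B ^ a n' * \<bar>\<xi> - of_int p / B ^ a n\<bar> \<le> B ^ a n' * B powr (- depth v n i)"
      by (intro mult_left_mono) auto
    also have "\<dots> = X" by (simp add: X_def powr_diff powr_minus powr_realpow field_simps)
    also have "B ^ a n' * \<bar>\<xi> - of_int p / B ^ a n\<bar> = \<bar>B ^ a n' * \<xi> - x\<bar>"
      unfolding x_def right_diff_distrib[symmetric] by (simp only: abs_mult) simp
    finally have "\<bar>B ^ a n' * \<xi> - x\<bar> \<le> X" .
    then have "p' \<in> Q" using near_set_ball0[OF near] unfolding Q_def R_def by simp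
    then show "\<xi> \<in> (\<Union>p'\<in>Q. near_set v N0 n' p')" using near by blast
  qed
  then have "hausdorff_premeasure \<delta> s (next_set v N0 n p i \<inter> {\<xi>. is_record \<xi> n'})
     \<le> hausdorff_premeasure \<delta> s (\<Union>p'\<in>Q. near_set v N0 n' p')"
    by (rule hausdorff_premeasure_mono)
  also have "\<dots> \<le> (\<Sum>p'\<in>Q. hausdorff_premeasure \<delta> s (near_set v N0 n' p'))"
    using assms(1) Q(1) by (intro hausdorff_premeasure_UN_finite) auto
  also have "\<dots> \<le> (\<Sum>p'\<in>Q. ennreal (B powr (- (y * a n'))))"
    using IH by (intro sum_mono) (simp add: n'_def)
  also have "\<dots> = ennreal (real (card Q) * B powr (- (y * a n')))"
    by (simp add: ennreal_mult ennreal_of_nat_eq_real_of_nat)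
  also have "\<dots> \<le> ennreal (5 * B powr (- min (y * a n') (y * a n' - a n' + depth v n i)))"
  proof (rule ennreal_leI)
    have "real (card Q) * B powr (- (y * a n')) \<le> (2 * X + 3) * B powr (- (y * a n'))"
      using Q(2) by (intro mult_right_mono) (auto simp: R_def)
    \<comment> \<open>The terms with \<open>2 * X\<close> and with \<open>3\<close> carry the two
      exponents of the minimum; the coefficients add up to the \<open>5\<close>.\<close>
    also have "\<dots> = 2 * B powr (- (y * a n' - a n' + depth v n i)) + 3 * B powr (- (y * a n'))"
      by (simp add: X_def algebra_simps flip: powr_add)
    also have "\<dots> \<le> 2 * B powr (- min (y * a n') (y * a n' - a n' + depth v n i))
        + 3 * B powr (- min (y * a n') (y * a n' - a n' + depth v n i))"
      by (intro add_mono mult_left_mono powr_mono) auto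
    finally show "real (card Q) * B powr (- (y * a n')) \<le> 5 * B powr (- min (y * a n') (y * a n' - a n' + depth v n i))"
      by simp
  qed
  finally show ?thesis by (simp only: n'_def)
qed

lemma depth_lim: "(\<lambda>n. depth v n i / real (a n)) \<longlonglongrightarrow> 1 + v * \<eta> ^ i"
proof -
  have "(\<lambda>n. 1 + v * (real (a (n + i)) / real (a n))) \<longlonglongrightarrow> 1 + v * \<eta> ^ i"
    by (intro tendsto_intros ratio_lim)
  moreover have "\<forall>\<^sub>F n in sequentially. 1 + v * (real (a (n + i)) / real (a n)) = depth v n i / real (a n)"
    using eventually_ge_at_top[of 1]
  proof eventually_elim
    case (elim n)
    then show ?case using pos_a[of n] by (simp add: depth_def field_simps)
  qed
  ultimately show ?thesis by (rule Lim_transform_eventually)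
qed

lemma eventually_small_ball:
  assumes "0 < \<delta>" "0 \<le> v"
  shows "\<forall>\<^sub>F n in sequentially. \<forall>i. 2 * B powr (- depth v n i) \<le> \<delta>"
proof -
  have "(\<lambda>n. real (a n) / real (a n)) \<longlonglongrightarrow> 1"
    using ratio_lim[of 0] by simp
  from eventually_le_powr[OF this, of 0 "2 / \<delta>"]
  have "\<forall>\<^sub>F n in sequentially. 2 * B powr (- real (a n)) \<le> \<delta>"
    using assms by (simp add: field_simps)
  then show ?thesis
  proof eventually_elim
    case (elim n)
    show ?case
    proof
      fix i
      have "B powr (- depth v n i) \<le> B powr (- real (a n))"
        using assms by (intro powr_mono) (auto simp: depth_def)
      then show "2 * B powr (- depth v n i) \<le> \<delta>" using elim by linarith
    qed
  qed
qed

text \<open>One step of the recursion. For each gap below \<open>L\<close>, \<open>alt\<close>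
  selects the cheaper method: the ball of the run, or the covers of cost exponent \<open>y\<close>
  at the next record. Gaps of at least \<open>L\<close> are left to the ball.\<close>

lemma premeasure_improve:
  fixes y z :: real
  assumes \<delta>: "0 < \<delta>" and s: "0 < s" and v: "0 \<le> v"
    and IH: "\<forall>\<^sub>F n in sequentially. \<forall>p. hausdorff_premeasure \<delta> s (near_set v N0 n p) \<le> ennreal (B powr (- (y * a n)))"
    and alt: "\<And>i. i < L \<Longrightarrow> z < s * (1 + v * \<eta> ^ i) \<or>
      (z < y * \<eta> ^ (i + 1) \<and> z < y * \<eta> ^ (i + 1) - \<eta> ^ (i + 1) + (1 + v * \<eta> ^ i))"
    and L: "z < s * (1 + v * \<eta> ^ L)"
  shows "\<forall>\<^sub>F n in sequentially. \<forall>p. hausdorff_premeasure \<delta> s (near_set v N0 n p) \<le> ennreal (B powr (- (z * a n)))"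
proof -
  \<comment> \<open>The number of pieces; each is allotted an equal share of the target
    cost.\<close>
  define K where "K = real L + 1"
  have K: "0 < K" by (simp add: K_def)
  have ball: "\<forall>\<^sub>F n in sequentially. \<forall>p. hausdorff_premeasure \<delta> s (next_set v N0 n p i) \<le> ennreal (B powr (- (z * a n)) / K)"
    if z: "z < s * (1 + v * \<eta> ^ i)" for i
  proof -
    have "(\<lambda>n. s * (depth v n i / real (a n))) \<longlonglongrightarrow> s * (1 + v * \<eta> ^ i)"
      by (intro tendsto_intros depth_lim)
    then have "(\<lambda>n. s * depth v n i / real (a n)) \<longlonglongrightarrow> s * (1 + v * \<eta> ^ i)" by simp
    from eventually_le_powr[OF this z, of "K * 2 powr s"] K
    have "\<forall>\<^sub>F n in sequentially. K * 2 powr s * B powr (- (s * depth v n i)) \<le> B powr (- (z * a n))"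
      by simp
    from this eventually_small_ball[OF \<delta> v] eventually_ge_at_top[of N0] show ?thesis
    proof eventually_elim
      case (elim n)
      show ?case
      proof
        fix p
        have "hausdorff_premeasure \<delta> s (next_set v N0 n p i) \<le> ennreal (2 powr s * B powr (- (s * depth v n i)))"
          using elim s by (intro next_set_premeasure_ball) auto
        also have "\<dots> \<le> ennreal (B powr (- (z * a n)) / K)"
          using elim(1) K by (intro ennreal_leI) (simp add: field_simps)
        finally show "hausdorff_premeasure \<delta> s (next_set v N0 n p i) \<le> ennreal (B powr (- (z * a n)) / K)" .
      qed
    qed
  qed
  have piece: "\<forall>\<^sub>F n in sequentially. \<forall>p. hausdorff_premeasure \<delta> s (next_set v N0 n p i \<inter> {\<xi>. is_record \<xi> (n + i + 1)})
      \<le> ennreal (B powr (- (z * a n)) / K)" if i: "i < L" for i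
    using alt[OF i]
  proof (elim disjE conjE)
    assume "z < s * (1 + v * \<eta> ^ i)"
    from ball[OF this] show ?thesis
      by eventually_elim (meson hausdorff_premeasure_mono inf_le1 order.trans)
  next
    assume z: "z < y * \<eta> ^ (i + 1)" "z < y * \<eta> ^ (i + 1) - \<eta> ^ (i + 1) + (1 + v * \<eta> ^ i)"
    define e1 where "e1 n = y * a (n + i + 1)" for n
    define e2 where "e2 n = y * a (n + i + 1) - a (n + i + 1) + depth v n i" for n
    have r: "(\<lambda>n. real (a (n + i + 1)) / real (a n)) \<longlonglongrightarrow> \<eta> ^ (i + 1)"
      using ratio_lim[of "i + 1"] by (simp add: add.assoc)
    have "(\<lambda>n. y * (real (a (n + i + 1)) / real (a n))) \<longlonglongrightarrow> y * \<eta> ^ (i + 1)"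
      by (intro tendsto_intros r)
    then have l1: "(\<lambda>n. e1 n / real (a n)) \<longlonglongrightarrow> y * \<eta> ^ (i + 1)" by (simp add: e1_def)
    have "(\<lambda>n. y * (real (a (n + i + 1)) / real (a n)) - real (a (n + i + 1)) / real (a n) + depth v n i / real (a n))
        \<longlonglongrightarrow> y * \<eta> ^ (i + 1) - \<eta> ^ (i + 1) + (1 + v * \<eta> ^ i)"
      by (intro tendsto_intros r depth_lim)
    then have l2: "(\<lambda>n. e2 n / real (a n)) \<longlonglongrightarrow> y * \<eta> ^ (i + 1) - \<eta> ^ (i + 1) + (1 + v * \<eta> ^ i)"
      by (simp add: e2_def add_divide_distrib diff_divide_distrib)
    have K5: "0 < K * 5" using K by simp
    have "\<forall>\<^sub>F n in sequentially. \<forall>p. hausdorff_premeasure \<delta> s (near_set v N0 (n + i + 1) p) \<le> ennreal (B powr (- (y * a (n + i + 1))))"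
      using IH unfolding eventually_sequentially by (meson trans_le_add1)
    from this eventually_le_powr[OF l1 z(1) K5] eventually_le_powr[OF l2 z(2) K5] eventually_ge_at_top[of N0]
    show ?thesis
    proof eventually_elim
      case (elim n)
      have le: "K * 5 * B powr (- min (e1 n) (e2 n)) \<le> B powr (- (z * a n))"
        using elim(2,3) by (simp add: min_def)
      show ?case
      proof
        fix p
        have "hausdorff_premeasure \<delta> s (next_set v N0 n p i \<inter> {\<xi>. is_record \<xi> (n + i + 1)}) \<le>
            ennreal (5 * B powr (- min (e1 n) (e2 n)))"
          unfolding e1_def e2_def using elim \<delta> by (intro next_set_premeasure_children) auto
        also have "\<dots> \<le> ennreal (B powr (- (z * a n)) / K)"
          using le K by (intro ennreal_leI) (simp add: field_simps)
        finally show "hausdorff_premeasure \<delta> s (next_set v N0 n p i \<inter> {\<xi>. is_record \<xi> (n + i + 1)}) \<le> ennreal (B powr (- (z * a n)) / K)" .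
      qed
    qed
  qed
  have "\<forall>\<^sub>F n in sequentially. \<forall>i\<in>{..<L}. \<forall>p. hausdorff_premeasure \<delta> s (next_set v N0 n p i \<inter> {\<xi>. is_record \<xi> (n + i + 1)})
      \<le> ennreal (B powr (- (z * a n)) / K)"
    using piece by (intro eventually_ball_finite) auto
  from this ball[OF L] show ?thesis
  proof eventually_elim
    case (elim n)
    define c where "c = B powr (- (z * a n)) / K"
    have c: "0 \<le> c" using K by (simp add: c_def)
    show ?case
    proof
      fix p
      have "hausdorff_premeasure \<delta> s (near_set v N0 n p) \<le> hausdorff_premeasure \<delta> s
        ((\<Union>i\<in>{..<L}. next_set v N0 n p i \<inter> {\<xi>. is_record \<xi> (n + i + 1)}) \<union> next_set v N0 n p L)"
        by (intro hausdorff_premeasure_mono near_set_subset_next)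
      also have "\<dots> \<le> hausdorff_premeasure \<delta> s (\<Union>i\<in>{..<L}. next_set v N0 n p i \<inter> {\<xi>. is_record \<xi> (n + i + 1)})
          + hausdorff_premeasure \<delta> s (next_set v N0 n p L)"
        using \<delta> by (intro hausdorff_premeasure_Un) simp
      also have "\<dots> \<le> (\<Sum>i<L. hausdorff_premeasure \<delta> s (next_set v N0 n p i \<inter> {\<xi>. is_record \<xi> (n + i + 1)})) + ennreal c"
        using \<delta> elim(2) by (intro add_mono hausdorff_premeasure_UN_finite) (auto simp: c_def)
      also have "\<dots> \<le> (\<Sum>i<L. ennreal c) + ennreal c"
        using elim(1) by (intro add_mono sum_mono) (auto simp: c_def)
      also have "\<dots> = ennreal (real L * c + c)"
        using c by (simp add: ennreal_mult ennreal_plus ennreal_of_nat_eq_real_of_nat)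
      also have "real L * c + c = c * K" by (simp add: K_def algebra_simps)
      also have "c * K = B powr (- (z * a n))" using K by (simp add: c_def)
      finally show "hausdorff_premeasure \<delta> s (near_set v N0 n p) \<le> ennreal (B powr (- (z * a n)))" .
    qed
  qed
qed

text \<open>The trivial ball gives every exponent below \<open>s * (1 + v)\<close>. The start
  \<open>s / 2\<close> is positive, which later keeps the gain bounded away from
  \<open>0\<close>.\<close>

lemma premeasure_base:
  assumes \<delta>: "0 < \<delta>" and s: "0 < s" and v: "0 \<le> v"
  shows "\<forall>\<^sub>F n in sequentially. \<forall>p. hausdorff_premeasure \<delta> s (near_set v N0 n p) \<le> ennreal (B powr (- (s / 2 * a n)))"
proof -
  have "(\<lambda>n. s * (depth v n 0 / real (a n))) \<longlonglongrightarrow> s * (1 + v * \<eta> ^ 0)"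
    by (intro tendsto_intros depth_lim)
  then have lim: "(\<lambda>n. s * depth v n 0 / real (a n)) \<longlonglongrightarrow> s * (1 + v)" by simp
  have pos2: "0 < 2 powr s" by simp
  have "s / 2 < s * (1 + v)" using s v by (simp add: algebra_simps add_strict_increasing)
  from eventually_le_powr[OF lim this pos2] eventually_small_ball[OF \<delta> v] eventually_ge_at_top[of N0]
  show ?thesis
  proof eventually_elim
    case (elim n)
    have eq: "near_set v N0 n p = next_set v N0 n p 0" for p by (auto simp: next_set_def)
    show ?case
    proof
      fix p
      have "hausdorff_premeasure \<delta> s (next_set v N0 n p 0) \<le> ennreal (2 powr s * B powr (- (s * depth v n 0)))"
        using elim s by (intro next_set_premeasure_ball) auto
      also have "\<dots> \<le> ennreal (B powr (- (s / 2 * a n)))"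
        using elim(1) by (intro ennreal_leI) simp
      finally show "hausdorff_premeasure \<delta> s (near_set v N0 n p) \<le> ennreal (B powr (- (s / 2 * a n)))"
        unfolding eq .
    qed
  qed
qed

text \<open>A Borel-Cantelli argument: at level \<open>n\<close> at most \<open>5 * B ^ a n\<close>
  integers \<open>p\<close> meet the unit interval, so the level costs at most
  \<open>5 * q ^ n\<close>. As every point has arbitrarily late records, each tail of this geometric
  series bounds the premeasure.\<close>

lemma approx_set_premeasure_0:
  fixes y :: real
  assumes \<delta>: "0 < \<delta>" and v: "0 < v" and y: "1 < y"
    and IH: "\<forall>\<^sub>F n in sequentially. \<forall>p. hausdorff_premeasure \<delta> s (near_set v N0 n p) \<le> ennreal (B powr (- (y * a n)))"
  shows "hausdorff_premeasure \<delta> s (approx_set v N0 \<inter> {of_int k..of_int k + 1}) = 0"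
proof -
  define q where "q = B powr (- (y - 1))"
  have q: "0 < q" "q < 1"
    using y powr_less_mono[of "- (y - 1)" 0 B] by (auto simp: q_def)
  define S where "S = approx_set v N0 \<inter> {of_int k..of_int k + 1}"
  obtain N1 where N1: "\<And>n p. N1 \<le> n \<Longrightarrow> hausdorff_premeasure \<delta> s (near_set v N0 n p) \<le> ennreal (B powr (- (y * a n)))"
    using IH unfolding eventually_sequentially by blast
  define Q where "Q n = {p::int. \<bar>of_int p - B ^ a n * of_int k\<bar> \<le> B ^ a n + 1}" for n
  have Q: "finite (Q n)" "real (card (Q n)) \<le> 5 * B ^ a n" for n
  proof -
    have one: "1 \<le> B ^ a n" by (intro one_le_power) simp
    note * = card_int_abs_diff_le[of "B ^ a n + 1" "B ^ a n * of_int k", folded Q_def]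
    have "0 \<le> B ^ a n + 1" using one by linarith
    note * = *[OF this]
    show "finite (Q n)" by (rule *(1))
    show "real (card (Q n)) \<le> 5 * B ^ a n" 
    proof -
      have "c \<le> 5 * X" if "1 \<le> X" "c \<le> 2 * (X + 1) + 1" for X c :: real
        using that by simp
      then show ?thesis using one *(2) by blast
    qed
  qed
  have level: "hausdorff_premeasure \<delta> s (\<Union>p\<in>Q n. near_set v N0 n p) \<le> ennreal (5 * q ^ n)"
    if n: "N1 \<le> n" "1 \<le> n" for n
  proof -
    have "hausdorff_premeasure \<delta> s (\<Union>p\<in>Q n. near_set v N0 n p) \<le> (\<Sum>p\<in>Q n. hausdorff_premeasure \<delta> s (near_set v N0 n p))"
      using \<delta> Q(1) by (intro hausdorff_premeasure_UN_finite) auto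
    also have "\<dots> \<le> (\<Sum>p\<in>Q n. ennreal (B powr (- (y * a n))))"
      using N1 n by (intro sum_mono)
    also have "\<dots> = ennreal (real (card (Q n)) * B powr (- (y * a n)))"
      by (simp add: ennreal_mult ennreal_of_nat_eq_real_of_nat)
    also have "\<dots> \<le> ennreal (5 * q ^ n)"
    proof (rule ennreal_leI)
      have "real (card (Q n)) * B powr (- (y * a n)) \<le> 5 * B ^ a n * B powr (- (y * a n))"
        using Q(2) by (intro mult_right_mono) auto
      also have "\<dots> = 5 * B powr (- (y - 1) * a n)"
        by (simp add: algebra_simps powr_diff powr_minus powr_realpow field_simps)
      also have "\<dots> \<le> 5 * B powr (- (y - 1) * n)"
      proof -
        have "- (y - 1) * a n \<le> - (y - 1) * n"
          using y a_ge[OF n(2)] by (intro mult_left_mono_neg) auto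
        then have "B powr (- (y - 1) * a n) \<le> B powr (- (y - 1) * n)" by (rule powr_mono) simp
        then show ?thesis by simp
      qed
      also have "\<dots> = 5 * q ^ n"
        by (simp add: q_def powr_powr flip: powr_realpow)
      finally show "real (card (Q n)) * B powr (- (y * a n)) \<le> 5 * q ^ n" .
    qed
    finally show ?thesis .
  qed
  have bound: "hausdorff_premeasure \<delta> s S \<le> ennreal (5 * q ^ N / (1 - q))" if N: "N1 \<le> N" "1 \<le> N" for N
  proof -
    have "S \<subseteq> (\<Union>m. \<Union>p\<in>Q (m + N). near_set v N0 (m + N) p)"
    proof
      fix \<xi> assume \<xi>: "\<xi> \<in> S"
      obtain n where n: "N < n" "is_record \<xi> n" using ex_record[of \<xi> v N0 N] \<xi> v by (auto simp: S_def)
      obtain p where p: "dist_nearest_int (B ^ a n * \<xi>) = \<bar>B ^ a n * \<xi> - of_int p\<bar>"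
        using dist_nearest_int_attained by blast
      have near: "\<xi> \<in> near_set v N0 n p" using \<xi> n p by (simp add: near_set_def S_def)
      have "\<bar>B ^ a n * \<xi> - B ^ a n * of_int k\<bar> = B ^ a n * \<bar>\<xi> - of_int k\<bar>"
        unfolding right_diff_distrib[symmetric] by (simp only: abs_mult) simp
      also have "\<dots> \<le> B ^ a n * 1" using \<xi> by (intro mult_left_mono) (auto simp: S_def)
      finally have "p \<in> Q n" using near_set_ball0[OF near] unfolding Q_def by simp
      then have "\<xi> \<in> (\<Union>p\<in>Q (n - N + N). near_set v N0 (n - N + N) p)" using near n by auto
      then show "\<xi> \<in> (\<Union>m. \<Union>p\<in>Q (m + N). near_set v N0 (m + N) p)" by blast
    qed
    then have "hausdorff_premeasure \<delta> s S \<le> hausdorff_premeasure \<delta> s (\<Union>m. \<Union>p\<in>Q (m + N). near_set v N0 (m + N) p)"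
      by (rule hausdorff_premeasure_mono)
    also have "\<dots> \<le> (\<Sum>m. hausdorff_premeasure \<delta> s (\<Union>p\<in>Q (m + N). near_set v N0 (m + N) p))"
      by (rule hausdorff_premeasure_UN_nat)
    also have "\<dots> \<le> (\<Sum>m. ennreal (5 * q ^ N * q ^ m))"
      using N by (intro suminf_le level[THEN order.trans]) (auto simp: power_add mult_ac)
    also have "\<dots> = ennreal (5 * q ^ N / (1 - q))"
    proof (rule suminf_ennreal_eq)
      show "(\<lambda>m. 5 * q ^ N * q ^ m) sums (5 * q ^ N / (1 - q))"
        using sums_mult[OF geometric_sums[of q], of "5 * q ^ N"] q by simp
    qed (use q in simp)
    finally show ?thesis .
  qed
  have "(\<lambda>N. 5 * q ^ N / (1 - q)) \<longlonglongrightarrow> 5 * 0 / (1 - q)"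
    using q by (intro tendsto_intros LIMSEQ_realpow_zero) auto
  then have "(\<lambda>N. ennreal (5 * q ^ N / (1 - q))) \<longlonglongrightarrow> ennreal (5 * 0 / (1 - q))"
    by (rule tendsto_ennrealI)
  moreover have "\<forall>\<^sub>F N in sequentially. hausdorff_premeasure \<delta> s S \<le> ennreal (5 * q ^ N / (1 - q))"
    using eventually_ge_at_top[of N1] eventually_ge_at_top[of 1] by eventually_elim (rule bound)
  ultimately have "hausdorff_premeasure \<delta> s S \<le> ennreal (5 * 0 / (1 - q))"
    by (intro tendsto_lowerbound) auto
  then show ?thesis by (simp add: S_def)
qed

lemma approx_set_null:
  assumes s: "0 < s" and v: "0 < v" and c: "0 < c"
    and alt: "\<And>i y. i < L \<Longrightarrow> s / 2 \<le> y \<Longrightarrow> y \<le> 1 \<Longrightarrow> y + c < s * (1 + v * \<eta> ^ i) \<or>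
      (y + c < y * \<eta> ^ (i + 1) \<and> y + c < y * \<eta> ^ (i + 1) - \<eta> ^ (i + 1) + (1 + v * \<eta> ^ i))"
    and L: "1 + c < s * (1 + v * \<eta> ^ L)"
  shows "hausdorff_measure s (approx_set v N0) = 0"
proof -
  have part: "hausdorff_premeasure \<delta> s (approx_set v N0 \<inter> {of_int k..of_int k + 1}) = 0" if \<delta>: "0 < \<delta>" for \<delta> k
  proof -
    define y where "y m = s / 2 + real m * c" for m
    \<comment> \<open>Minimality gives \<open>y k \<le> 1\<close> at all earlier steps, the range in
      which \<open>alt\<close> and \<open>L\<close> apply.\<close>
    define m where "m = (LEAST m. 1 < y m)"
    obtain m0 :: nat where "real m0 > 1 / c" using reals_Archimedean2 by blast
    then have "1 < y m0" using c s by (simp add: y_def field_simps add_strict_increasing)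
    then have m: "1 < y m" unfolding m_def by (rule LeastI)
    have "\<forall>\<^sub>F n in sequentially. \<forall>p. hausdorff_premeasure \<delta> s (near_set v N0 n p) \<le> ennreal (B powr (- (y k * a n)))"
      if "k \<le> m" for k
      using that
    proof (induction k)
      case 0
      then show ?case using premeasure_base[OF \<delta> s, of v N0] v by (simp add: y_def)
    next
      case (Suc k)
      have "y k \<le> 1" using not_less_Least[of k "\<lambda>m. 1 < y m"] Suc.prems by (auto simp: m_def)
      have "s / 2 \<le> y k" using c by (simp add: y_def)
      have eq: "y (Suc k) = y k + c" by (simp add: y_def algebra_simps)
      show ?case
        unfolding eq
      proof (rule premeasure_improve[OF \<delta> s less_imp_le[OF v]])
        show "\<forall>\<^sub>F n in sequentially. \<forall>p. hausdorff_premeasure \<delta> s (near_set v N0 n p) \<le> ennreal (B powr (- (y k * a n)))"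
          using Suc.prems by (intro Suc.IH) simp
        show "y k + c < s * (1 + v * \<eta> ^ L)" using L \<open>y k \<le> 1\<close> by linarith
      qed (rule alt[OF _ \<open>s / 2 \<le> y k\<close> \<open>y k \<le> 1\<close>])
    qed
    from approx_set_premeasure_0[OF \<delta> v m this[OF order.refl]] show ?thesis .
  qed
  have "hausdorff_measure s (\<Union>k::int\<in>UNIV. approx_set v N0 \<inter> {of_int k..of_int k + 1}) = 0"
    using part by (intro hausdorff_measure_null_UN) (auto simp: hausdorff_measure_eq_0_iff)
  moreover have "approx_set v N0 \<subseteq> (\<Union>k::int\<in>UNIV. approx_set v N0 \<inter> {of_int k..of_int k + 1})"
  proof
    fix \<xi> assume "\<xi> \<in> approx_set v N0"
    then have "\<xi> \<in> approx_set v N0 \<inter> {of_int \<lfloor>\<xi>\<rfloor>..of_int \<lfloor>\<xi>\<rfloor> + 1}" by (auto intro: less_imp_le)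
    then show "\<xi> \<in> (\<Union>k::int\<in>UNIV. approx_set v N0 \<inter> {of_int k..of_int k + 1})" by blast
  qed
  ultimately show ?thesis by (rule hausdorff_measure_null_mono)
qed

text \<open>The supremum defining \<open>v_hat\<close> may fail to be attained, so a point of
  \<open>V_set b a v\<close> yields approximations only to each order \<open>w < v\<close>.\<close>

lemma V_set_subset:
  assumes "0 \<le> w" "w < v"
  shows "V_set b a v \<subseteq> \<rat> \<union> (\<Union>N0\<in>UNIV. approx_set w N0)"
proof
  fix \<xi> assume "\<xi> \<in> V_set b a v"
  then have "ereal w < v_hat b a \<xi>" using assms by (auto simp: V_set_def intro: less_le_trans[of _ "ereal v"])
  then obtain x where x: "w < x" "\<forall>\<^sub>F N in sequentially. min_dist \<xi> N < B powr (- (x * a N))"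
    unfolding v_hat_eq less_Sup_iff by auto
  have "B powr (- (x * a N)) \<le> B powr (- (w * a N))" for N
    using x(1) by (intro powr_mono) (auto intro: mult_right_mono)
  with x(2) have "\<forall>\<^sub>F N in sequentially. min_dist \<xi> N < B powr (- (w * a N))"
    by (auto elim!: eventually_mono intro: less_le_trans)
  then show "\<xi> \<in> \<rat> \<union> (\<Union>N0\<in>UNIV. approx_set w N0)"
    unfolding eventually_sequentially by (auto simp: approx_set_def)
qed

text \<open>If the block length \<open>i + 1\<close> does not pay off directly (\<open>s (1 + v \<eta>\<^sup>i) \<le> y + c\<close>), then
  the exponent \<open>y\<close> lies above the fixed point of the affine map \<open>y \<mapsto> (y - 1) \<eta>\<^sup>i\<^sup>+\<^sup>1 + 1 + v \<eta>\<^sup>i\<close>,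
  which therefore increases it.\<close>

lemma exponent_gain:
  assumes v: "0 < v" and c0: "block_dim \<eta> v i \<le> s - c0" and c: "0 < c" "2 * c * \<eta> < (\<eta> - 1) * c0"
    and y: "s * (1 + v * \<eta> ^ i) \<le> y + c"
  shows "y + c < y * \<eta> ^ (i + 1) - \<eta> ^ (i + 1) + (1 + v * \<eta> ^ i)"
proof -
  define x where "x = \<eta> ^ (i + 1)"
  define W where "W = 1 + v * \<eta> ^ i"
  define fp where "fp = (x - W) / (x - 1)"
  have x: "\<eta> \<le> x" "1 < x"
  proof -
    show "\<eta> \<le> x" using eta power_increasing[of 1 "i + 1" \<eta>] by (simp add: x_def)
    then show "1 < x" using eta by simp
  qed
  have W: "1 \<le> W" using v eta by (simp add: W_def)
  \<comment> \<open>Here \<open>fp\<close> is the fixed point; thus \<open>s > block_dim\<close>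
    means that the exponent \<open>s * W\<close> of the ball exceeds it.\<close>
  have "block_dim \<eta> v i = fp / W"
    by (simp add: block_dim_def fp_def x_def W_def algebra_simps)
  then have "fp \<le> (s - c0) * W" using c0 W by (simp add: pos_divide_le_eq)
  moreover have "0 < c0"
  proof -
    have "0 < 2 * c * \<eta>" using c eta by simp
    then have "0 < (\<eta> - 1) * c0" using c by linarith
    then show ?thesis using eta by (simp add: zero_less_mult_iff)
  qed
  then have "c0 \<le> c0 * W" using W by simp
  ultimately have "c0 - c \<le> y - fp" using y by (simp add: W_def[symmetric] algebra_simps)
  \<comment> \<open>The hypothesis on \<open>c\<close> makes the first two terms positive together,
    so the right side exceeds \<open>c\<close>.\<close>
  have "(\<eta> - 1) * (c0 - c) = (\<eta> - 1) * c0 - 2 * c * \<eta> + c * \<eta> + c"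
    by (simp add: algebra_simps)
  moreover have "0 < c * \<eta>" using c eta by simp
  ultimately have "c < (\<eta> - 1) * (c0 - c)" using c by linarith
  also have "\<dots> \<le> (x - 1) * (y - fp)"
  proof (rule mult_mono)
    show "0 \<le> c0 - c"
    proof -
      have "(\<eta> - 1) * c0 \<le> \<eta> * c0" using \<open>0 < c0\<close> by simp
      then have "\<eta> * (2 * c) < \<eta> * c0" using c by (simp add: mult_ac)
      then show ?thesis using eta c by simp
    qed
  qed (use x \<open>c0 - c \<le> y - fp\<close> in auto)
  also have "\<dots> = (x - 1) * y - (x - 1) * fp" by (rule right_diff_distrib)
  also have "(x - 1) * fp = x - W" using x by (simp add: fp_def)
  finally show ?thesis by (simp add: x_def W_def algebra_simps)
qed

lemma hausdorff_measure_V_set_null: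
  assumes s: "0 < s" and v: "0 < v" and D: "\<And>i. block_dim \<eta> v i < s"
  shows "hausdorff_measure s (V_set b a v) = 0"
proof -
  \<comment> \<open>\<open>L\<close> is chosen with \<open>v / 2\<close> so that it serves every
    \<open>w\<close> between \<open>v / 2\<close> and \<open>v\<close>. Only finitely many gaps then
    restrict how close \<open>w\<close> must be to \<open>v\<close>.\<close>
  obtain L where "2 / (s * (v / 2)) < \<eta> ^ L"
    using real_arch_pow[OF eta] by blast
  then have L: "2 \<le> s * (v / 2) * \<eta> ^ L"
    using s v by (simp add: field_simps)
  have "\<forall>\<^sub>F w in at_left v. \<forall>i\<in>{..<L}. block_dim \<eta> w i < s"
  proof (intro eventually_ball_finite ballI)
    fix i
    have "((\<lambda>w. block_dim \<eta> w i) \<longlongrightarrow> block_dim \<eta> v i) (at_left v)"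
    proof -
      have "1 < \<eta> ^ (i + 1)" using eta by (intro one_less_power) auto
      moreover have "0 < 1 + \<eta> ^ i * v" using eta v by (intro add_pos_pos mult_pos_pos) auto
      ultimately show ?thesis
        unfolding block_dim_def by (intro tendsto_intros) auto
    qed
    then show "\<forall>\<^sub>F w in at_left v. block_dim \<eta> w i < s" using D by (rule order_tendstoD)
  qed simp
  moreover have "\<forall>\<^sub>F w in at_left v. w \<in> {v/2<..<v}"
    using v by (intro eventually_at_leftI[of "v / 2"]) auto
  ultimately have "\<forall>\<^sub>F w in at_left v. (\<forall>i\<in>{..<L}. block_dim \<eta> w i < s) \<and> w \<in> {v/2<..<v}"
    by eventually_elim auto
  then obtain w where "\<forall>i\<in>{..<L}. block_dim \<eta> w i < s" "w \<in> {v/2<..<v}"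
    using eventually_happens'[OF trivial_limit_at_left_real] by blast
  then have w: "\<And>i. i < L \<Longrightarrow> block_dim \<eta> w i < s" "v / 2 < w" "w < v"
    by auto
  have w0: "0 < w" using w v by linarith
  \<comment> \<open>The element \<open>1\<close> keeps the set nonempty when
    \<open>L = 0\<close>.\<close>
  define c0 where "c0 = Min (insert 1 ((\<lambda>i. s - block_dim \<eta> w i) ` {..<L}))"
  have c0: "0 < c0" "\<And>i. i < L \<Longrightarrow> c0 \<le> s - block_dim \<eta> w i"
    using w(1) by (auto simp: c0_def intro!: Min_le)
  \<comment> \<open>In this order: the condition of \<open>exponent_gain\<close>, the increase of
    \<open>y * \<eta> ^ (i + 1)\<close> over \<open>y\<close> for \<open>y \<ge> s / 2\<close>, and
    \<open>1 + c < 2\<close> for the gaps of at least \<open>L\<close>.\<close>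
  define c where "c = Min {(\<eta> - 1) * c0 / (4 * \<eta>), s / 2 * (\<eta> - 1) / 2, 1 / 2}"
  have c: "0 < c" "c \<le> (\<eta> - 1) * c0 / (4 * \<eta>)" "c \<le> s / 2 * (\<eta> - 1) / 2" "c \<le> 1 / 2"
    using c0(1) eta s by (auto simp: c_def)
  have "hausdorff_measure s (approx_set w N0) = 0" for N0
  proof (rule approx_set_null[OF s w0 c(1)])
    have "s * (v / 2) * \<eta> ^ L \<le> s * w * \<eta> ^ L" using w s eta by (intro mult_right_mono mult_left_mono) auto
    moreover have "s * (1 + w * \<eta> ^ L) = s + s * w * \<eta> ^ L" by (simp add: algebra_simps)
    ultimately show "1 + c < s * (1 + w * \<eta> ^ L)" using L c(4) s by linarith
  next
    fix i y assume i: "i < L" and y: "s / 2 \<le> y" "y \<le> 1"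
    show "y + c < s * (1 + w * \<eta> ^ i) \<or>
      (y + c < y * \<eta> ^ (i + 1) \<and> y + c < y * \<eta> ^ (i + 1) - \<eta> ^ (i + 1) + (1 + w * \<eta> ^ i))"
    proof (cases "y + c < s * (1 + w * \<eta> ^ i)")
      case False
      have gain: "2 * c * \<eta> < (\<eta> - 1) * c0"
      proof -
        have "4 * \<eta> * c \<le> (\<eta> - 1) * c0" using c(2) eta by (simp add: field_simps)
        moreover have "0 < \<eta> * c" using eta c(1) by simp
        ultimately show ?thesis by (simp add: mult_ac)
      qed
      have "block_dim \<eta> w i \<le> s - c0" using c0(2)[OF i] by linarith
      then have "y + c < y * \<eta> ^ (i + 1) - \<eta> ^ (i + 1) + (1 + w * \<eta> ^ i)"
        using False by (intro exponent_gain[OF w0 _ c(1) gain, of i s]) linarith+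
      moreover have "y + c < y * \<eta> ^ (i + 1)"
      proof -
        have "s / 2 * (\<eta> - 1) \<le> y * (\<eta> - 1)" using y eta by (intro mult_right_mono) auto
        moreover have "0 < s / 2 * (\<eta> - 1)" using s eta by simp
        moreover have "y * (\<eta> - 1) = y * \<eta> - y" by (simp add: algebra_simps)
        ultimately have "y + c < y * \<eta>" using c(3) by linarith
        also have "\<eta> \<le> \<eta> ^ (i + 1)" using eta power_increasing[of 1 "i + 1" \<eta>] by simp
        then have "y * \<eta> \<le> y * \<eta> ^ (i + 1)" using y s by (intro mult_left_mono) auto
        finally show ?thesis .
      qed
      ultimately show ?thesis by blast
    qed simp
  qed
  then have 1: "hausdorff_measure s (\<Union>N0\<in>UNIV. approx_set w N0) = 0"
    by (intro hausdorff_measure_null_UN) auto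
  have 2: "hausdorff_measure s (\<rat> :: real set) = 0"
    using s by (intro hausdorff_measure_null_countable countable_rat)
  have "hausdorff_measure s (\<Union>x\<in>{True, False}. if x then \<rat> else (\<Union>N0\<in>UNIV. approx_set w N0)) = 0"
    using 1 2 by (intro hausdorff_measure_null_UN) auto
  then show ?thesis
    by (rule hausdorff_measure_null_mono) (use V_set_subset[of w v] w w0 in auto)
qed

end

section \<open>The optimal block length\<close>

text \<open>After cross-multiplication the difference is
  \<open>\<eta> * v * ((x - u) * (w * u * x - x - u))\<close> with \<open>u = \<eta> ^ l\<close>,
  \<open>x = \<eta> ^ i\<close> and \<open>w = \<eta> - v\<close>. For \<open>i > l\<close> the
  lower bound makes both variable factors nonnegative, by \<open>2 * x \<ge> x + u\<close>; for
  \<open>i < l\<close> the upper bound and \<open>\<eta> * x \<le> u\<close> make both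
  nonpositive.\<close>

lemma block_dim_le_block_dim:
  assumes eta: "1 < \<eta>" and v: "0 < v" and ge: "2 \<le> \<eta> ^ l * (\<eta> - v)" and le: "\<eta> ^ l * (\<eta> - v) \<le> \<eta> + 1"
  shows "block_dim \<eta> v i \<le> block_dim \<eta> v l"
proof -
  define u where "u = \<eta> ^ l"
  define x where "x = \<eta> ^ i"
  define w where "w = \<eta> - v"
  have u: "1 \<le> u" "1 \<le> x" using eta by (auto simp: u_def x_def)
  have 1: "1 < \<eta> * u" "1 < \<eta> * x" using u eta by (auto intro: less_le_trans[of 1 \<eta>])
  have 2: "0 < 1 + u * v" "0 < 1 + x * v" using u v by (auto intro: add_pos_pos)
  have sign: "0 \<le> (x - u) * (w * u * x - x - u)"
  proof (cases "l = i")
    case True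
    then show ?thesis by (simp add: u_def x_def)
  next
    case neq: False
    show ?thesis
    proof (cases "l < i")
      case True
      then have "u \<le> x" using eta by (auto simp: u_def x_def)
      moreover have "2 * x \<le> (u * w) * x" using ge u by (intro mult_right_mono) (auto simp: u_def w_def)
      ultimately show ?thesis by (intro mult_nonneg_nonneg) (auto simp: mult_ac)
    next
      case False
      then have "i + 1 \<le> l" using neq by simp
      then have "\<eta> ^ (i + 1) \<le> \<eta> ^ l" using eta by (intro power_increasing) auto
      then have ux: "\<eta> * x \<le> u" by (simp add: u_def x_def)
      moreover have "1 * x \<le> \<eta> * x" using u eta by (intro mult_right_mono) auto
      moreover have "(u * w) * x \<le> (\<eta> + 1) * x" using le u by (intro mult_right_mono) (auto simp: u_def w_def)
      ultimately have "x - u \<le> 0" "w * u * x - x - u \<le> 0" by (auto simp: algebra_simps)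
      then show ?thesis by (rule mult_nonpos_nonpos)
    qed
  qed
  have "(x * w - 1) * ((\<eta> * u - 1) * (1 + u * v)) \<le> (u * w - 1) * ((\<eta> * x - 1) * (1 + x * v))"
  proof -
    have "(u * w - 1) * ((\<eta> * x - 1) * (1 + x * v)) - (x * w - 1) * ((\<eta> * u - 1) * (1 + u * v))
        = \<eta> * v * ((x - u) * (w * u * x - x - u))"
      unfolding w_def by (simp add: algebra_simps power2_eq_square)
    moreover have "0 \<le> \<eta> * v * ((x - u) * (w * u * x - x - u))"
      using eta v by (intro mult_nonneg_nonneg[OF _ sign]) simp
    ultimately show ?thesis by linarith
  qed
  then have "(x * w - 1) / ((\<eta> * x - 1) * (1 + x * v)) \<le> (u * w - 1) / ((\<eta> * u - 1) * (1 + u * v))"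
  proof -
    have "p / P \<le> q / Q" if "p * Q \<le> q * P" "0 < P" "0 < Q" for p q P Q :: real
      using that by (simp add: field_simps)
    then show ?thesis using 1 2 \<open>(x * w - 1) * _ \<le> _\<close> by (auto intro!: mult_pos_pos)
  qed
  moreover have "block_dim \<eta> v k = (\<eta> ^ k * w - 1) / ((\<eta> * \<eta> ^ k - 1) * (1 + \<eta> ^ k * v))" for k
    unfolding block_dim_def
    by (rule arg_cong2[where f = "(/)"]) (simp_all add: w_def algebra_simps)
  ultimately show ?thesis
    by (simp add: u_def x_def)
qed

text \<open>With \<open>u = \<eta> ^ l\<close>, the left end point is
  \<open>(\<eta> * u - 1) * (u - 1) / u ^ 2\<close>, which is positive; the second claim drops the
  \<open>- 1\<close> from its numerator.\<close>

lemma v_range_pos: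
  assumes "1 < \<eta>" "1 \<le> l" "\<eta> - (\<eta> ^ l + \<eta> ^ (l + 1) - 1) / \<eta> ^ (2 * l) \<le> v"
  shows "0 < v" "\<eta> ^ l * (\<eta> - v) < \<eta> + (1::real)"
proof -
  define u where "u = \<eta> ^ l"
  have u: "1 < u" using assms by (auto simp: u_def intro!: one_less_power)
  have "(\<eta> - v) \<le> (u + \<eta> * u - 1) / u\<^sup>2"
    using assms(3) by (simp add: u_def power_mult mult.commute[of 2] flip: power_Suc)
  then have *: "u\<^sup>2 * (\<eta> - v) \<le> u + \<eta> * u - 1"
    using u by (simp add: field_simps)
  then have "u * (u * (\<eta> - v)) < u * (\<eta> + 1)" by (simp add: power2_eq_square algebra_simps)
  then show "\<eta> ^ l * (\<eta> - v) < \<eta> + 1" using u by (simp add: u_def)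
  have "1 * 1 < \<eta> * u" using assms(1) u by (intro mult_strict_mono) auto
  then have "0 < (\<eta> * u - 1) * (u - 1)" using u by simp
  also have "\<dots> \<le> u\<^sup>2 * v" using * by (simp add: power2_eq_square algebra_simps)
  finally show "0 < v" using u by (simp add: zero_less_mult_iff)
qed

text \<open>The floor is the largest exponent \<open>l\<close> with
  \<open>\<eta> ^ l * (\<eta> - v) \<le> \<eta> + 1\<close>; the next one fails because
  \<open>2 * \<eta> > \<eta> + 1\<close>.\<close>

lemma l_tilde_eq:
  assumes "1 < \<eta>" "1 \<le> l" "2 \<le> \<eta> ^ l * (\<eta> - v)" "\<eta> ^ l * (\<eta> - v) < \<eta> + 1"
  shows "l_tilde \<eta> v = l"
proof -
  have w: "0 < \<eta> - v"
  proof -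
    have "0 < \<eta> ^ l * (\<eta> - v)" using assms by linarith
    then show ?thesis using assms(1) by (simp add: zero_less_mult_iff)
  qed
  have ln: "0 < ln \<eta>" using assms by simp
  have "real l * ln \<eta> + ln (\<eta> - v) = ln (\<eta> ^ l * (\<eta> - v))"
    using w assms(1) by (simp add: ln_mult ln_realpow)
  moreover have "ln (\<eta> ^ l * (\<eta> - v)) < ln (\<eta> + 1)"
    using assms by (subst ln_less_cancel_iff) auto
  moreover have "ln (\<eta> + 1) < ln (\<eta> * (\<eta> ^ l * (\<eta> - v)))"
  proof (subst ln_less_cancel_iff)
    have "\<eta> + 1 < \<eta> * 2" using assms(1) by simp
    also have "\<dots> \<le> \<eta> * (\<eta> ^ l * (\<eta> - v))" using assms by (intro mult_left_mono) auto
    finally show "\<eta> + 1 < \<eta> * (\<eta> ^ l * (\<eta> - v))" .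
  qed (use assms w in auto)
  moreover have "ln (\<eta> * (\<eta> ^ l * (\<eta> - v))) = ln \<eta> + ln (\<eta> ^ l * (\<eta> - v))"
    using assms w by (intro ln_mult_pos) auto
  ultimately have "\<lfloor>(ln (\<eta> + 1) - ln (\<eta> - v)) / ln \<eta>\<rfloor> = int l"
    using ln by (intro floor_unique) (auto simp: field_simps)
  then show ?thesis using assms(2) by (simp add: l_tilde_def)
qed

theorem corollary1p8:
  fixes b :: int and a :: "nat \<Rightarrow> nat" and \<eta> v :: real
  assumes "b \<ge> 2"
    and "strict_mono_on {1..} a"
    and "\<forall>n\<ge>1. a n > 0"
    and "(\<lambda>n. real (a (n + 1)) / real (a n)) \<longlonglongrightarrow> \<eta>"
    and "1 < \<eta>"
    and "v \<in> (\<Union>l\<in>{l_zero \<eta>..}. {\<eta> - (\<eta> ^ l + \<eta> ^ (l + 1) - 1) / \<eta> ^ (2 * l) .. \<eta> - 2 / \<eta> ^ l})"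
  shows "hausdorff_dim (V_star_set b a v) = hausdorff_dim (V_set b a v)
    \<and> hausdorff_dim (V_set b a v) =
        ereal ((\<eta> ^ (l_tilde \<eta> v + 1) - 1 - \<eta> ^ l_tilde \<eta> v * v)
          / ((\<eta> ^ (l_tilde \<eta> v + 1) - 1) * (1 + \<eta> ^ l_tilde \<eta> v * v)))"
proof -
  interpret lacunary b a \<eta>
    using assms by unfold_locales auto
  obtain l where l0: "l_zero \<eta> \<le> l" and v_ge: "\<eta> - (\<eta> ^ l + \<eta> ^ (l + 1) - 1) / \<eta> ^ (2 * l) \<le> v"
    and v_le: "v \<le> \<eta> - 2 / \<eta> ^ l"
    using assms(6) by auto
  have l: "1 \<le> l" using l0 by (simp add: l_zero_def)
  note v = v_range_pos[OF assms(5) l v_ge]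
  have "0 < \<eta> ^ l" using assms(5) by simp
  then have "\<eta> ^ l * (2 / \<eta> ^ l) \<le> \<eta> ^ l * (\<eta> - v)" using v_le by (intro mult_left_mono) auto
  then have ge: "2 \<le> \<eta> ^ l * (\<eta> - v)" using assms(5) by simp
  have lt: "l_tilde \<eta> v = l" by (rule l_tilde_eq[OF assms(5) l ge v(2)])
  define D where "D = block_dim \<eta> v l"
  have D0: "0 < D"
  proof -
    have "1 < \<eta> ^ (l + 1)" using assms(5) by (intro one_less_power) auto
    moreover have "0 < 1 + \<eta> ^ l * v" using v(1) \<open>0 < \<eta> ^ l\<close> by (intro add_pos_pos mult_pos_pos) auto
    moreover have "0 < \<eta> ^ (l + 1) - 1 - \<eta> ^ l * v" using ge by (simp add: algebra_simps)
    ultimately show ?thesis unfolding D_def block_dim_def by (intro divide_pos_pos mult_pos_pos) auto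
  qed
  have upper: "hausdorff_dim (V_set b a v) \<le> ereal D"
  proof (rule hausdorff_dim_le)
    fix s assume s: "D < s"
    have "block_dim \<eta> v i < s" for i
      using block_dim_le_block_dim[OF assms(5) v(1) ge less_imp_le[OF v(2)], of i] s by (simp add: D_def)
    then show "hausdorff_measure s (V_set b a v) = 0"
      using s D0 v(1) by (intro hausdorff_measure_V_set_null) auto
  qed (use D0 in simp)
  \<comment> \<open>A gap \<open>i = l\<close> means blocks of \<open>l + 1\<close> indices, hence
    \<open>j = Suc l\<close>.\<close>
  have cantor: "cantor b a \<eta> v (Suc l) s" if "0 < s" "s < D" for s
  proof unfold_locales
    show "1 + \<eta> ^ (Suc l - 1) * v < \<eta> ^ Suc l" using ge by (simp add: algebra_simps)
  qed (use that v(1) in \<open>auto simp: D_def\<close>)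
  have lower: "ereal D \<le> hausdorff_dim (V_star_set b a v)"
  proof (rule hausdorff_dim_ge)
    fix s assume s: "0 \<le> s" "s < D"
    show "hausdorff_measure s (V_star_set b a v) \<noteq> 0"
    proof (cases "s = 0")
      case False
      then have "0 < s" using s by simp
      from cantor.hausdorff_measure_V_star_set_ne_0[OF cantor[OF this s(2)]] show ?thesis .
    next
      case True
      \<comment> \<open>Any exponent strictly between \<open>0\<close> and \<open>D\<close>, such as
        \<open>D / 2\<close>, yields a Cantor set and hence a point.\<close>
      have "V_star_set b a v \<noteq> {}"
        using D0 by (intro cantor.V_star_set_nonempty[OF cantor[of "D / 2"]]) auto
      then show ?thesis unfolding True by (rule hausdorff_measure_0_ne_0)
    qed
  qed
  have "hausdorff_dim (V_star_set b a v) \<le> hausdorff_dim (V_set b a v)"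
    by (intro hausdorff_dim_mono) (auto simp: V_star_set_def V_set_def)
  with upper lower have "hausdorff_dim (V_star_set b a v) = ereal D" "hausdorff_dim (V_set b a v) = ereal D"
    by auto
  then show ?thesis by (simp add: lt D_def block_dim_def)
qed


end
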